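(* Let $\tau=u+iv\in\mathbb H$ and $q=e^{2\pi i\tau}$. Define \[ g_1(q):=\sum_{n\ge1}\frac{q^n}{n(1+q^n)}, \] and \[ \widehat g_1(\tau):=2\log(2)-\gamma+\frac{6\zeta'(2)}{\pi^2}-\frac{\pi}{2}v+\frac{\log(v)}{2}+g_1(q)+g_1(\overline q), \] where $\gamma$ is the Euler–Mascheroni constant and $\zeta$ is the Riemann zeta function. Then $\widehat g_1$ is a sesquiharmonic Maass form of weight $0$ on $\Gamma_0(2)$. Moreover, \[ \xi_0\bigl(\widehat g_1(\tau)\bigr)=\frac{\pi}{6}\Bigl(\widehat E_2(\tau)-4\widehat E_2(2\tau)\Bigr), \] where \[ \widehat E_2(\tau):=1-24\sum_{n\ge1}\sigma_1(n)q^n-\frac{3}{\pi v} \] and $\sigma_1(n)=\sum_{d\mid n}d$.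
   Context: For $k\in\mathbb Z$, the shadow operator is $\xi_k:=2iv^k\overline{\frac{\partial}{\partial\overline\tau}}$. A real-analytic function $f:\mathbb H\to\mathbb C$ is a sesquiharmonic Maass form of weight $k$ on $\Gamma_0(N)$ if it satisfies the following three conditions: 1. $f\bigl(\frac{a\tau+b}{c\tau+d}\bigr)=(c\tau+d)^kf(\tau)$ for all $\begin{pmatrix}a&b\\c&d\end{pmatrix}\in\Gamma_0(N)$; 2. $-\xi_k\circ\xi_{2-k}\circ\xi_k(f)=0$; 3. $f$ has at most linear exponential growth at the cusps of $\Gamma_0(N)$. *)

theory Defs
  imports "HOL-Analysis.Analysis" "HOL-Library.Landau_Symbols"
begin

text \<open>Functions on the upper half-plane are represented by total functions on \<^typ>\<open>complex\<close>;
  only their values on \<open>\<H>\<close> matter.\<close>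

definition upper_half_plane :: "complex set" ("\<H>") where
  "\<H> = {\<tau>. Im \<tau> > 0}"


subsection \<open>Modular groups\<close>

definition SL2Z :: "(int ^ 2 ^ 2) set" where
  "SL2Z = {A. det A = 1}"

definition Gamma0 :: "nat \<Rightarrow> (int ^ 2 ^ 2) set" where
  "Gamma0 N = {A \<in> SL2Z. int N dvd A $ 2 $ 1}"

definition moebius :: "int ^ 2 ^ 2 \<Rightarrow> complex \<Rightarrow> complex" where
  "moebius A \<tau> = (of_int (A $ 1 $ 1) * \<tau> + of_int (A $ 1 $ 2)) /
                 (of_int (A $ 2 $ 1) * \<tau> + of_int (A $ 2 $ 2))"

definition automorphy_factor :: "int ^ 2 ^ 2 \<Rightarrow> complex \<Rightarrow> complex" where
  "automorphy_factor A \<tau> = of_int (A $ 2 $ 1) * \<tau> + of_int (A $ 2 $ 2)"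


subsection \<open>Real-analytic functions and the shadow operator\<close>

text \<open>Near every point, \<open>f\<close> is the sum of a convergent power series in the two real variables
  \<open>u - Re z\<close> and \<open>v - Im z\<close>; \<open>has_sum\<close> here amounts to absolute convergence.\<close>

definition real_analytic_on :: "(complex \<Rightarrow> complex) \<Rightarrow> complex set \<Rightarrow> bool"
    (infix "real'_analytic'_on" 50) where
  "f real_analytic_on S \<longleftrightarrow>
     (\<forall>z\<in>S. \<exists>r>0. \<exists>a :: nat \<Rightarrow> nat \<Rightarrow> complex. \<forall>x y :: real. \<bar>x\<bar> < r \<longrightarrow> \<bar>y\<bar> < r \<longrightarrow>
        ((\<lambda>(m, n). a m n * of_real x ^ m * of_real y ^ n) has_sum f (z + Complex x y)) UNIV)"

text \<open>The Wirtinger derivative with respect to the conjugate of \<open>\<tau> = u + \<i> v\<close>, that is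
  \<open>(\<partial>/\<partial>u + \<i> \<partial>/\<partial>v) / 2\<close>.\<close>

definition dbar :: "(complex \<Rightarrow> complex) \<Rightarrow> complex \<Rightarrow> complex" where
  "dbar f \<tau> = (vector_derivative (\<lambda>t. f (\<tau> + of_real t)) (at 0)
             + \<i> * vector_derivative (\<lambda>t. f (\<tau> + \<i> * of_real t)) (at 0)) / 2"

definition shadow :: "int \<Rightarrow> (complex \<Rightarrow> complex) \<Rightarrow> complex \<Rightarrow> complex" ("\<xi>") where
  "\<xi> k f \<tau> = 2 * \<i> * of_real (Im \<tau>) powi k * cnj (dbar f \<tau>)"


subsection \<open>Sesquiharmonic Maass forms\<close>

text \<open>Every cusp is of the form \<open>A \<infinity>\<close> with \<open>A \<in> SL\<^sub>2(\<int>)\<close>, and growth at that cusp is growth of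
  \<open>f|\<^sub>k A\<close> as \<open>v \<rightarrow> \<infinity>\<close>, uniformly in \<open>u\<close>.\<close>

definition linear_exponential_growth_at_cusps :: "int \<Rightarrow> (complex \<Rightarrow> complex) \<Rightarrow> bool" where
  "linear_exponential_growth_at_cusps k f \<longleftrightarrow>
     (\<forall>A\<in>SL2Z. \<exists>C::real.
        (\<lambda>\<tau>. norm (automorphy_factor A \<tau> powi (- k) * f (moebius A \<tau>)))
          \<in> O[filtercomap Im at_top](\<lambda>\<tau>. exp (C * Im \<tau>)))"

definition sesquiharmonic_Maass_form :: "int \<Rightarrow> nat \<Rightarrow> (complex \<Rightarrow> complex) \<Rightarrow> bool" where
  "sesquiharmonic_Maass_form k N f \<longleftrightarrow>
     f real_analytic_on \<H> \<and>
     (\<forall>A\<in>Gamma0 N. \<forall>\<tau>\<in>\<H>. f (moebius A \<tau>) = automorphy_factor A \<tau> powi k * f \<tau>) \<and>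
     (\<forall>\<tau>\<in>\<H>. - (\<xi> k (\<xi> (2 - k) (\<xi> k f))) \<tau> = 0) \<and>
     linear_exponential_growth_at_cusps k f"


subsection \<open>The functions \<open>g\<^sub>1\<close> and \<open>E\<^sub>2\<close>\<close>

text \<open>Riemann's zeta function on \<open>Re s > 1\<close>, which determines \<open>\<zeta>'(2)\<close>. Where the Dirichlet series
  diverges, the value carries no meaning.\<close>

definition Riemann_zeta :: "complex \<Rightarrow> complex" where
  "Riemann_zeta s = (\<Sum>n. 1 / of_nat (Suc n) powr s)"

definition nome :: "complex \<Rightarrow> complex" where
  "nome \<tau> = exp (2 * of_real pi * \<i> * \<tau>)"

definition g1 :: "complex \<Rightarrow> complex" where
  "g1 q = (\<Sum>n. q ^ Suc n / (of_nat (Suc n) * (1 + q ^ Suc n)))"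

definition g1_hat :: "complex \<Rightarrow> complex" where
  "g1_hat \<tau> = 2 * of_real (ln 2) - euler_mascheroni + 6 * deriv Riemann_zeta 2 / of_real pi ^ 2
     - of_real pi / 2 * of_real (Im \<tau>) + of_real (ln (Im \<tau>)) / 2
     + g1 (nome \<tau>) + g1 (cnj (nome \<tau>))"

definition sigma1 :: "nat \<Rightarrow> nat" where
  "sigma1 n = (\<Sum>d | d dvd n. d)"

definition E2_hat :: "complex \<Rightarrow> complex" where
  "E2_hat \<tau> = 1 - 24 * (\<Sum>n. of_nat (sigma1 (Suc n)) * nome \<tau> ^ Suc n)
     - 3 / (of_real pi * of_real (Im \<tau>))"

end

(* Since x/(1 + x) = x/(1 - x) - 2 x^2/(1 - x^2), the completed function g1_hat is, up to an additive
   constant, 4 h(2 tau) - 2 h(tau), where h = log (v^(1/4) |eta|) and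
   log eta = pi i tau / 12 - sum_n q^n / (n (1 - q^n)). Everything thus reduces to the modularity of
   Dedekind's eta function. The derivative of log eta is, up to constants, Eisenstein's conditionally
   convergent double series sum 1/(m tau + n)^2. Interchanging the order of summation produces the
   quasi-modular defect; it is computed by subtracting a telescoping double series that
   makes the remainder absolutely convergent, the cotangent expansion giving the boundary term.
   Integrating yields eta(-1/tau) up to a constant, which is fixed at tau = i. Because 2 A tau is again
   an integral Moebius image of 2 tau, of tau/2 or of (tau + 1)/2, both the invariance under Gamma_0(2)
   and the growth at all cusps follow from the SL_2(Z)-invariance of h. *)

theory Submission
  imports Defs "HOL-Complex_Analysis.Complex_Analysis"
begin

subsection \<open>Partial fractions of the cotangent and of the inverse squared sine\<close>

text \<open>Absolute values keep the argument short: the roots of unity in the multiplier system of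
  eta disappear, and v^(1/4) absorbs the factor of weight 1/2, so h is exactly invariant and no
  transformation constant has to be tracked. The obstacle is that the sum of 1/(m tau + n)^2
  narrowly fails to converge absolutely. Terms of cubic order do converge, because |m tau + n|^2 is
  at least a constant times |m n|. Comparing 1/z^2 with 1/(z (z + 1)) gains the missing order and
  telescopes at the same time. The remaining claims rest on a splitting of \<open>g1_hat\<close>
  into a constant, a function of v, a holomorphic function G and its conjugate. The first shadow
  turns this into a function of v plus 2 i G', the second into the constant -1/2, the third into 0.
  The comparison with E_2 is the rearrangement of a Lambert series.\<close>

lemma Ints_nonpos_shift:
  fixes z :: complex
  assumes "z \<notin> \<int>"
  shows "z \<notin> \<int>\<^sub>\<le>\<^sub>0" "1 - z \<notin> \<int>\<^sub>\<le>\<^sub>0" "1 + z \<notin> \<int>\<^sub>\<le>\<^sub>0" "z \<noteq> 0"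
proof -
  have "1 - z \<notin> \<int>" "1 + z \<notin> \<int>"
    using assms by (metis Ints_1 Ints_diff add_diff_cancel_left' diff_diff_eq2 diff_add_cancel)+
  then show "z \<notin> \<int>\<^sub>\<le>\<^sub>0" "1 - z \<notin> \<int>\<^sub>\<le>\<^sub>0" "1 + z \<notin> \<int>\<^sub>\<le>\<^sub>0" "z \<noteq> 0"
    using assms nonpos_Ints_subset_Ints by auto
qed

lemma sin_pi_nonzero:
  fixes z :: complex
  assumes "z \<notin> \<int>"
  shows "sin (of_real pi * z) \<noteq> 0"
proof
  assume "sin (of_real pi * z) = 0"
  then obtain n :: int where "of_real pi * z = of_real (of_int n * pi)"
    by (auto simp: sin_eq_0)
  then have "z = of_int n" by simp
  then show False using assms by simp
qed

text \<open>Differentiate both sides of Euler's reflection formula for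
  \<open>Gamma z * Gamma (1 - z)\<close> and cancel the common factor
  \<open>of_real pi / sin (of_real pi * z)\<close>.\<close>

lemma Digamma_reflection_complex:
  fixes z :: complex
  assumes z: "z \<notin> \<int>"
  shows "Digamma (1 - z) - Digamma z = of_real pi * cot (of_real pi * z)"
proof -
  note nz = Ints_nonpos_shift[OF z]
  let ?s = "sin (of_real pi * z)" and ?c = "cos (of_real pi * z)"
  have s: "?s \<noteq> 0" by (rule sin_pi_nonzero[OF z])
  have "((\<lambda>z. Gamma z * Gamma (1 - z)) has_field_derivative
      Gamma z * Gamma (1 - z) * (Digamma z - Digamma (1 - z))) (at z)"
    by (rule derivative_eq_intros nz refl | simp add: nz algebra_simps)+
  moreover have "((\<lambda>z. Gamma z * Gamma (1 - z)) has_field_derivative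
      - (of_real pi * (of_real pi * ?c)) / ?s\<^sup>2) (at z)"
    unfolding Gamma_reflection_complex
    by (rule derivative_eq_intros refl | simp add: s power2_eq_square)+
  ultimately have "of_real pi / ?s * (Digamma z - Digamma (1 - z)) = - (of_real pi * (of_real pi * ?c)) / ?s\<^sup>2"
    using DERIV_unique Gamma_reflection_complex by metis
  also have "\<dots> = of_real pi / ?s * - (of_real pi * (?c / ?s))"
    by (simp add: power2_eq_square)
  finally have "Digamma z - Digamma (1 - z) = - (of_real pi * (?c / ?s))"
    using s by (subst (asm) mult_cancel_left) simp
  then show ?thesis unfolding cot_def by (metis minus_diff_eq minus_minus)
qed

text \<open>Derivative of the previous reflection formula, which holds on the open complement of the
  integers.\<close>

lemma Trigamma_reflection_complex:
  fixes z :: complex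
  assumes z: "z \<notin> \<int>"
  shows "Polygamma 1 (1 - z) + Polygamma 1 z = (of_real pi / sin (of_real pi * z))\<^sup>2"
proof -
  note nz = Ints_nonpos_shift[OF z]
  let ?s = "sin (of_real pi * z)"
  have s: "?s \<noteq> 0" by (rule sin_pi_nonzero[OF z])
  have "((\<lambda>z. Digamma (1 - z) - Digamma z) has_field_derivative
      - Polygamma 1 (1 - z) - Polygamma 1 z) (at z)"
    by (rule derivative_eq_intros nz refl | simp add: nz)+
  moreover have "((\<lambda>z. Digamma (1 - z) - Digamma z) has_field_derivative
      - (of_real pi / ?s)\<^sup>2) (at z)"
  proof (rule has_field_derivative_transform_within_open)
    show "((\<lambda>z. of_real pi * cot (of_real pi * z)) has_field_derivative - (of_real pi / ?s)\<^sup>2) (at z)"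
      by (rule derivative_eq_intros DERIV_chain2[OF DERIV_cot] s refl)+
         (simp add: power2_eq_square divide_inverse mult_ac)
    show "open (- \<int> :: complex set)" using closed_Ints by blast
  qed (use z in \<open>auto simp: Digamma_reflection_complex\<close>)
  ultimately have "- Polygamma 1 (1 - z) - Polygamma 1 z = - (of_real pi / ?s)\<^sup>2"
    by (rule DERIV_unique)
  then show ?thesis by (metis add.commute minus_add_distrib neg_equal_iff_equal uminus_add_conv_diff add_uminus_conv_diff)
qed

text \<open>Subtract the Digamma series at \<open>1 + z\<close> from the one at
  \<open>1 - z\<close>: the harmonic terms and the Euler constants cancel, and what remains pairs
  the poles at \<open>n + 1\<close> and \<open>-(n + 1)\<close>. The recurrence for
  \<open>Digamma (1 + z)\<close> splits off the pole at \<open>0\<close>.\<close>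

lemma cot_partial_fractions:
  fixes z :: complex
  assumes z: "z \<notin> \<int>"
  shows "(\<lambda>n. 1 / (z + of_nat (Suc n)) + 1 / (z - of_nat (Suc n)))
    sums (of_real pi * cot (of_real pi * z) - 1 / z)"
proof -
  note nz = Ints_nonpos_shift[OF z]
  have S: "(\<lambda>k. inverse (of_nat (Suc k)) - inverse (w + of_nat k)) sums (Digamma w + euler_mascheroni)"
    if "w \<notin> \<int>\<^sub>\<le>\<^sub>0" for w :: complex
    using summable_Digamma[of w] that by (auto simp: Digamma_def summable_sums)
  have "(\<lambda>k. (inverse (of_nat (Suc k)) - inverse ((1 - z) + of_nat k)) -
             (inverse (of_nat (Suc k)) - inverse ((1 + z) + of_nat k)))
    sums (Digamma (1 - z) + euler_mascheroni - (Digamma (1 + z) + euler_mascheroni))"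
    by (intro sums_diff S nz)
  moreover have "Digamma (1 + z) = Digamma z + 1 / z"
    using Digamma_plus1[OF nz(4)] by (simp add: add.commute)
  moreover have "(inverse (of_nat (Suc k)) - inverse ((1 - z) + of_nat k)) -
             (inverse (of_nat (Suc k)) - inverse ((1 + z) + of_nat k))
      = 1 / (z + of_nat (Suc k)) + 1 / (z - of_nat (Suc k))" for k
  proof -
    have "(1 - z) + of_nat k = - (z - of_nat (Suc k))" by simp
    then have "inverse ((1 - z) + of_nat k) = - inverse (z - of_nat (Suc k))"
      by (metis inverse_minus_eq)
    then show ?thesis by (simp add: inverse_eq_divide add_ac)
  qed
  ultimately show ?thesis
    using Digamma_reflection_complex[OF z] by (simp add: algebra_simps)
qed

lemma sin_inverse_square_partial_fractions:
  fixes z :: complex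
  assumes z: "z \<notin> \<int>"
  shows "(\<lambda>n. 1 / (z + of_nat (Suc n))\<^sup>2 + 1 / (z - of_nat (Suc n))\<^sup>2)
    sums ((of_real pi / sin (of_real pi * z))\<^sup>2 - 1 / z\<^sup>2)"
proof -
  note nz = Ints_nonpos_shift[OF z]
  have S: "(\<lambda>k. inverse ((w + of_nat k)\<^sup>2)) sums (Polygamma 1 w)"
    if "w \<notin> \<int>\<^sub>\<le>\<^sub>0" for w :: complex
  proof -
    have "w \<noteq> 0" using that by auto
    then show ?thesis
      using Polygamma_converges'[of w 2] by (auto simp: Polygamma_def summable_sums numeral_2_eq_2)
  qed
  have "(\<lambda>k. inverse (((1 + z) + of_nat k)\<^sup>2) + inverse (((1 - z) + of_nat k)\<^sup>2))
    sums (Polygamma 1 (1 + z) + Polygamma 1 (1 - z))"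
    by (intro sums_add S nz)
  moreover have "Polygamma 1 (1 + z) = Polygamma 1 z - 1 / z\<^sup>2"
    using Polygamma_plus1[OF nz(4), of 1] by (simp add: add.commute numeral_2_eq_2)
  moreover have "inverse (((1 + z) + of_nat k)\<^sup>2) + inverse (((1 - z) + of_nat k)\<^sup>2)
      = 1 / (z + of_nat (Suc k))\<^sup>2 + 1 / (z - of_nat (Suc k))\<^sup>2" for k
  proof -
    have "((1 - z) + of_nat k)\<^sup>2 = (z - of_nat (Suc k))\<^sup>2" by (simp add: power2_eq_square algebra_simps)
    then show ?thesis by (simp add: inverse_eq_divide add_ac)
  qed
  moreover have "Polygamma 1 z - 1 / z\<^sup>2 + Polygamma 1 (1 - z)
      = (of_real pi / sin (of_real pi * z))\<^sup>2 - 1 / z\<^sup>2"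
    unfolding Trigamma_reflection_complex[OF z, symmetric] by (simp add: algebra_simps)
  ultimately show ?thesis by (simp only:)
qed

subsection \<open>Summation over the lattice\<close>

text \<open>The imaginary part of the point bounds its modulus in terms of \<open>m\<close>; the
  imaginary part of the point divided by \<open>t\<close> bounds it in terms of
  \<open>\<bar>x\<bar>\<close>. The product of the two bounds suits a double series over a product
  index set.\<close>

lemma norm_lattice_point_ge:
  assumes t: "Im t > 0" and m: "m \<ge> 0"
  shows "(norm (of_real m * t + of_real x))\<^sup>2 \<ge> (Im t)\<^sup>2 / norm t * (m * \<bar>x\<bar>)"
proof -
  have t0: "t \<noteq> 0" using t by auto
  let ?z = "of_real m * t + of_real x"
  have 1: "norm ?z \<ge> m * Im t"
    using abs_Im_le_cmod[of ?z] by simp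
  have "?z / t = of_real m + of_real x / t" using t0 by (simp add: field_simps)
  then have "\<bar>Im (of_real x / t)\<bar> \<le> norm (?z / t)"
    using abs_Im_le_cmod[of "?z / t"] by simp
  also have "Im (of_real x / t) = - x * Im t / (norm t)\<^sup>2"
    by (simp add: Im_divide cmod_power2)
  finally have "\<bar>x\<bar> * Im t / (norm t)\<^sup>2 \<le> norm ?z / norm t"
    using t by (simp add: abs_mult norm_divide)
  then have 2: "\<bar>x\<bar> * Im t / norm t \<le> norm ?z"
    using t0 by (simp add: field_simps power2_eq_square)
  have "(Im t)\<^sup>2 / norm t * (m * \<bar>x\<bar>) = (m * Im t) * (\<bar>x\<bar> * Im t / norm t)"
    by (simp add: power2_eq_square)
  also have "\<dots> \<le> norm ?z * norm ?z"
    by (intro mult_mono 1 2) (use t in auto)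
  finally show ?thesis by (simp add: power2_eq_square)
qed

lemma summable_on_powr_product:
  "(\<lambda>(m, n). (real (Suc m) * real (Suc n)) powr (-3/2)) summable_on (UNIV \<times> UNIV)"
proof -
  have s: "summable (\<lambda>n. real (Suc n) powr (-3/2))"
    using summable_real_powr_iff[of "-3/2"] by (subst summable_Suc_iff[of "\<lambda>n. real n powr (-3/2)"]) auto
  then have h: "(\<lambda>n. real (Suc n) powr (-3/2)) summable_on UNIV"
    by (simp add: summable_on_UNIV_nonneg_real_iff)
  show ?thesis
  proof (rule summable_on_SigmaI)
    fix m :: nat
    show "((\<lambda>n. (\<lambda>(m, n). (real (Suc m) * real (Suc n)) powr (-3/2)) (m, n))
       has_sum real (Suc m) powr (-3/2) * infsum (\<lambda>n. real (Suc n) powr (-3/2)) UNIV) UNIV"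
      using has_sum_cmult_right[OF has_sum_infsum[OF h], of "real (Suc m) powr (-3/2)"]
      by (simp add: powr_mult)
    show "(\<lambda>m. real (Suc m) powr (-3/2) * infsum (\<lambda>n. real (Suc n) powr (-3/2)) UNIV) summable_on UNIV"
      by (intro summable_on_cmult_left h)
  qed auto
qed

text \<open>Each of the three factors is at least the square root of a constant times
  \<open>m * r\<close>, whence the exponent \<open>-3/2\<close>, small enough for summability in
  both indices. Two offsets \<open>x\<close> and \<open>y\<close> are allowed because telescoping
  multiplies neighbouring lattice points.\<close>

lemma norm_cubic_lattice_term_le:
  fixes t :: complex
  assumes t: "Im t > 0" and m: "m > 0" and xy: "0 < r" "r \<le> \<bar>x\<bar>" "r \<le> \<bar>y\<bar>"
  shows "norm (1 / ((of_real m * t + of_real x)\<^sup>2 * (of_real m * t + of_real y)))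
    \<le> ((Im t)\<^sup>2 / norm t) powr (-3/2) * (m * r) powr (-3/2)"
proof -
  have t0: "t \<noteq> 0" using t by auto
  define k where "k = (Im t)\<^sup>2 / norm t"
  have k: "k > 0" using t t0 by (simp add: k_def)
  have kp: "k * (m * r) > 0" using k m xy by simp
  have x: "(norm (of_real m * t + of_real u))\<^sup>2 \<ge> k * (m * r)" if "r \<le> \<bar>u\<bar>" for u
  proof -
    have "k * (m * r) \<le> k * (m * \<bar>u\<bar>)"
      using k m that by (intro mult_left_mono) auto
    also have "\<dots> \<le> (norm (of_real m * t + of_real u))\<^sup>2"
      unfolding k_def using norm_lattice_point_ge[OF t] m by simp
    finally show ?thesis .
  qed
  have y: "norm (of_real m * t + of_real y) \<ge> (k * (m * r)) powr (1/2)"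
    using real_sqrt_le_mono[OF x[OF xy(3)]] kp by (simp add: powr_half_sqrt)
  have "(k * (m * r)) powr (3/2) = (k * (m * r)) * (k * (m * r)) powr (1/2)"
    using powr_add[of "k * (m * r)" 1 "1/2"] kp by simp
  also have "\<dots> \<le> (norm (of_real m * t + of_real x))\<^sup>2 * norm (of_real m * t + of_real y)"
    by (intro mult_mono x y xy) auto
  finally have "1 / ((norm (of_real m * t + of_real x))\<^sup>2 * norm (of_real m * t + of_real y))
       \<le> 1 / (k * (m * r)) powr (3/2)"
    by (rule frac_le[rotated 3]) (use k m xy in simp_all)
  also have "\<dots> = k powr (-3/2) * (m * r) powr (-3/2)"
    using k m xy by (simp add: powr_minus_divide powr_mult)
  finally show ?thesis by (simp add: k_def norm_divide norm_mult norm_power)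
qed

text \<open>Bridge between ordered series, in which the partial fractions are stated, and
  unconditional sums, for which Fubini's theorem is available.\<close>

lemma iterated_sums_of_summable:
  fixes f :: "nat \<Rightarrow> nat \<Rightarrow> complex"
  assumes "(\<lambda>(m, n). f m n) summable_on (UNIV \<times> UNIV)" and r: "\<And>m. (\<lambda>n. f m n) sums r m"
  shows "r sums infsum (\<lambda>(m, n). f m n) (UNIV \<times> UNIV)"
proof -
  have s: "(\<lambda>n. f m n) summable_on UNIV" for m
    by (rule summable_on_SigmaD1[OF assms(1)]) (rule UNIV_I)
  have "((\<lambda>n. f m n) has_sum r m) UNIV" for m
    using has_sum_infsum[OF s[of m]] sums_unique2[OF has_sum_imp_sums[OF has_sum_infsum[OF s[of m]]] r[of m]]
    by (simp only:)
  then have "(r has_sum infsum (\<lambda>(m, n). f m n) (UNIV \<times> UNIV)) UNIV"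
    by (intro has_sum_SigmaD[where B = "\<lambda>_. UNIV", OF has_sum_infsum[OF assms(1)]]) simp
  then show ?thesis by (rule has_sum_imp_sums)
qed

lemma iterated_sums_swap:
  fixes f :: "nat \<Rightarrow> nat \<Rightarrow> complex"
  assumes s: "(\<lambda>(m, n). f m n) summable_on (UNIV \<times> UNIV)"
    and r: "\<And>m. (\<lambda>n. f m n) sums r m" and c: "\<And>n. (\<lambda>m. f m n) sums c n"
  obtains D where "r sums D" "c sums D"
proof
  show "r sums infsum (\<lambda>(m, n). f m n) (UNIV \<times> UNIV)"
    using s r by (rule iterated_sums_of_summable)
  have s': "(\<lambda>(n, m). f m n) summable_on (UNIV \<times> UNIV)"
    using s by (subst summable_on_swap) simp
  have "c sums infsum (\<lambda>(n, m). f m n) (UNIV \<times> UNIV)"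
    using s' c by (rule iterated_sums_of_summable)
  also have "infsum (\<lambda>(n, m). f m n) (UNIV \<times> UNIV) = infsum (\<lambda>(m, n). f m n) (UNIV \<times> UNIV)"
    using has_sum_infsum[OF s] by (subst (asm) has_sum_swap) (simp add: infsumI case_prod_beta)
  finally show "c sums infsum (\<lambda>(m, n). f m n) (UNIV \<times> UNIV)" .
qed

text \<open>Written in \<open>exp (-2 * \<i> * w)\<close>, which decays low in the lower half-plane,
  the cotangent becomes \<open>\<i>\<close> times a quotient tending to \<open>1\<close>. The
  quasi-modular defect originates in this limit.\<close>

lemma cot_tendsto_imaginary_unit:
  assumes "filterlim (\<lambda>n. Im (w n)) at_bot F"
  shows "((\<lambda>n. cot (w n)) \<longlongrightarrow> \<i>) F"
proof -
  have "((\<lambda>n. exp (2 * Im (w n))) \<longlongrightarrow> 0) F"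
    by (rule filterlim_compose[OF exp_at_bot]) (rule filterlim_tendsto_pos_mult_at_bot[OF tendsto_const _ assms], simp)
  moreover have "norm (exp (-2 * \<i> * w n)) = exp (2 * Im (w n))" for n by simp
  ultimately have e: "((\<lambda>n. exp (-2 * \<i> * w n)) \<longlongrightarrow> 0) F"
    by (subst tendsto_norm_zero_iff[symmetric]) (simp only:)
  have "((\<lambda>n. \<i> * (1 + exp (-2 * \<i> * w n)) / (1 - exp (-2 * \<i> * w n))) \<longlongrightarrow> \<i> * (1 + 0) / (1 - 0)) F"
    by (intro tendsto_intros e) auto
  moreover have "\<i> * (1 + exp (-2 * \<i> * z)) / (1 - exp (-2 * \<i> * z)) = cot z" for z
  proof -
    have e1: "exp (-2 * \<i> * z) = exp (- (\<i> * z)) * exp (- (\<i> * z))" and e2: "exp (\<i> * z) * exp (- (\<i> * z)) = 1"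
      by (simp_all add: mult.assoc flip: exp_add)
    have "exp (\<i> * z) * (1 + exp (-2 * \<i> * z)) = exp (\<i> * z) + exp (- (\<i> * z))"
      "exp (\<i> * z) * (1 - exp (-2 * \<i> * z)) = exp (\<i> * z) - exp (- (\<i> * z))"
      using e2 unfolding e1 by (simp_all add: algebra_simps flip: mult.assoc)
    then have "\<i> * (1 + exp (-2 * \<i> * z)) / (1 - exp (-2 * \<i> * z)) =
        \<i> * (exp (\<i> * z) + exp (- (\<i> * z))) / (exp (\<i> * z) - exp (- (\<i> * z)))"
      by (metis (no_types) exp_not_eq_zero mult.left_commute nonzero_mult_divide_mult_cancel_left)
    also have "\<dots> = cot z"
      by (simp add: cot_def sin_exp_eq cos_exp_eq divide_simps) (simp add: algebra_simps)
    finally show ?thesis .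
  qed
  ultimately show ?thesis by simp
qed

lemma not_Ints_of_Im: "Im z \<noteq> 0 \<Longrightarrow> z \<notin> \<int>"
  by (auto simp: complex_is_Int_iff)

locale eisenstein_sums =
  fixes t :: complex
  assumes Im_pos: "Im t > 0"
begin

text \<open>The telescoping potential: its decrement in \<open>n\<close> is
  \<open>1 / (z * (z + 1)) + 1 / (z' * (z' - 1))\<close>, where \<open>z\<close> and
  \<open>z'\<close> are the two lattice points occurring here. That approximates
  \<open>a m n\<close>.\<close>

definition B :: "nat \<Rightarrow> nat \<Rightarrow> complex" where
  "B m n = 1 / (of_nat (Suc m) * t + of_nat (Suc n)) - 1 / (of_nat (Suc m) * t - of_nat (Suc n))"

text \<open>Eisenstein's terms with opposite \<open>n\<close> paired. Indices start at
  \<open>1\<close>, so the two axes are left out; they return as values of \<open>\<zeta>(2)\<close>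
  in \<open>eisenstein_weight_two_transformation\<close>.\<close>

definition a :: "nat \<Rightarrow> nat \<Rightarrow> complex" where
  "a m n = 1 / (of_nat (Suc m) * t + of_nat (Suc n))\<^sup>2 + 1 / (of_nat (Suc m) * t - of_nat (Suc n))\<^sup>2"

definition d :: "nat \<Rightarrow> nat \<Rightarrow> complex" where
  "d m n = a m n - (B m n - B m (Suc n))"

definition C :: "nat \<Rightarrow> complex" where
  "C n = 1 / t * (of_real pi * cot (of_real pi * (of_nat (Suc n) / t)) - 1 / (of_nat (Suc n) / t))"

lemma t_nonzero [simp]: "t \<noteq> 0"
  using Im_pos by auto

lemma Im_nat_divide: "Im (of_nat (Suc n) / t) = - (Im t / (norm t)\<^sup>2) * real (Suc n)"
  by (simp add: Im_divide cmod_power2)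

lemma not_Ints: "of_nat (Suc m) * t \<notin> \<int>" "of_nat (Suc n) / t \<notin> \<int>"
  using Im_pos Im_nat_divide[of n] by (auto intro!: not_Ints_of_Im)

lemma lattice_nonzero:
  "of_nat (Suc m) * t + of_nat n \<noteq> 0" "of_nat (Suc m) * t - of_nat n \<noteq> 0"
  using Im_pos by (auto simp: complex_eq_iff)

text \<open>Dividing the lattice points by \<open>t\<close> exchanges the roles of \<open>m\<close>
  and \<open>n\<close>, so a column of \<open>B\<close> is a cotangent series at
  \<open>(n + 1) / t\<close>.\<close>

lemma B_sums: "(\<lambda>m. B m n) sums C n"
proof -
  let ?w = "of_nat (Suc n) / t"
  have "(\<lambda>m. 1 / t * (1 / (?w + of_nat (Suc m)) + 1 / (?w - of_nat (Suc m)))) sums C n"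
    unfolding C_def by (intro sums_mult cot_partial_fractions not_Ints)
  moreover have "1 / t * (1 / (?w + of_nat (Suc m)) + 1 / (?w - of_nat (Suc m))) = B m n" for m
  proof -
    have "1 / (?w + of_nat (Suc m)) = t * (1 / (of_nat (Suc m) * t + of_nat (Suc n)))"
      "1 / (?w - of_nat (Suc m)) = - (t * (1 / (of_nat (Suc m) * t - of_nat (Suc n))))"
      using lattice_nonzero[of m "Suc n"] by (simp_all add: divide_simps) (simp_all add: algebra_simps)
    then show ?thesis by (simp add: B_def algebra_simps)
  qed
  ultimately show ?thesis by simp
qed

lemma B_tendsto: "B m \<longlonglongrightarrow> 0"
proof -
  have f: "filterlim (\<lambda>n. of_nat (Suc m) * t + of_nat (Suc n)) at_infinity sequentially"
    "filterlim (\<lambda>n. of_nat (Suc m) * t - of_nat (Suc n)) at_infinity sequentially"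
  proof -
    have "filterlim (\<lambda>n. of_nat (Suc n) :: complex) at_infinity sequentially"
      using filterlim_compose[OF tendsto_of_nat filterlim_Suc] .
    then show "filterlim (\<lambda>n. of_nat (Suc m) * t + of_nat (Suc n)) at_infinity sequentially"
      by (intro tendsto_add_filterlim_at_infinity[OF tendsto_const])
    have "filterlim (\<lambda>n. - (of_nat (Suc n) :: complex)) at_infinity sequentially"
      by (rule filterlim_norm_at_top_imp_at_infinity, unfold norm_minus_cancel norm_of_nat)
         (rule filterlim_compose[OF filterlim_real_sequentially filterlim_Suc])
    then show "filterlim (\<lambda>n. of_nat (Suc m) * t - of_nat (Suc n)) at_infinity sequentially"
      unfolding diff_conv_add_uminus by (intro tendsto_add_filterlim_at_infinity[OF tendsto_const])
  qed
  have "(\<lambda>n. 1 / (of_nat (Suc m) * t + of_nat (Suc n)) - 1 / (of_nat (Suc m) * t - of_nat (Suc n)))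
      \<longlonglongrightarrow> 0 - 0"
    by (intro tendsto_diff tendsto_divide_0[OF tendsto_const] f)
  then show ?thesis by (simp add: B_def[abs_def])
qed

text \<open>The points \<open>(n + 1) / t\<close> descend in the lower half-plane, where the
  cotangent tends to \<open>\<i>\<close>.\<close>

lemma C_tendsto: "C \<longlonglongrightarrow> \<i> * of_real pi / t"
proof -
  have "filterlim (\<lambda>n. - (pi * (Im t / (norm t)\<^sup>2)) * real (Suc n)) at_bot sequentially"
  proof (rule filterlim_tendsto_neg_mult_at_bot[OF tendsto_const])
    show "filterlim (\<lambda>n. real (Suc n)) at_top sequentially"
      by (rule filterlim_compose[OF filterlim_real_sequentially filterlim_Suc])
  qed (use Im_pos in simp)
  moreover have "Im (of_real pi * (of_nat (Suc n) / t)) = - (pi * (Im t / (norm t)\<^sup>2)) * real (Suc n)" for n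
  proof -
    have "Im (of_real pi * (of_nat (Suc n) / t)) = pi * Im (of_nat (Suc n) / t)"
      by (simp only: times_complex.simps Re_complex_of_real Im_complex_of_real mult_zero_left add_0_right)
    then show ?thesis unfolding Im_nat_divide by simp
  qed
  ultimately have 1: "(\<lambda>n. cot (of_real pi * (of_nat (Suc n) / t))) \<longlonglongrightarrow> \<i>"
    by (intro cot_tendsto_imaginary_unit) (simp only:)
  have 2: "(\<lambda>n. 1 / (of_nat (Suc n) / t)) \<longlonglongrightarrow> 0"
  proof -
    have "(\<lambda>n. t * inverse (of_nat (Suc n))) \<longlonglongrightarrow> t * 0"
      by (intro tendsto_intros LIMSEQ_Suc[OF lim_inverse_n])
    then show ?thesis by (simp add: field_simps)
  qed
  have "C \<longlonglongrightarrow> 1 / t * (of_real pi * \<i> - 0)"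
    unfolding C_def[abs_def] by (intro tendsto_intros 1 2)
  then show ?thesis by (simp add: mult_ac)
qed

text \<open>The gain of one order is
  \<open>1 / z^2 - 1 / (z * (z + 1)) = 1 / (z^2 * (z + 1))\<close>, together with its mirror image
  in which \<open>z - 1\<close> replaces \<open>z + 1\<close>.\<close>

lemma d_eq:
  "d m n = 1 / ((of_nat (Suc m) * t + of_nat (Suc n))\<^sup>2 * (of_nat (Suc m) * t + of_nat (Suc (Suc n))))
         - 1 / ((of_nat (Suc m) * t - of_nat (Suc n))\<^sup>2 * (of_nat (Suc m) * t - of_nat (Suc (Suc n))))"
proof -
  have *: "1 / z\<^sup>2 - 1 / z + 1 / (z + 1) = 1 / (z\<^sup>2 * (z + 1))"
    "1 / z\<^sup>2 + 1 / z - 1 / (z - 1) = - (1 / (z\<^sup>2 * (z - 1)))"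
    if "z \<noteq> 0" "z + 1 \<noteq> 0" "z - 1 \<noteq> 0" for z :: complex
    using that by (simp_all add: divide_simps) (simp_all add: algebra_simps power2_eq_square)
  let ?z = "of_nat (Suc m) * t + of_nat (Suc n)" and ?z' = "of_nat (Suc m) * t - of_nat (Suc n)"
  have eq: "of_nat (Suc m) * t + of_nat (Suc (Suc n)) = ?z + 1"
    "of_nat (Suc m) * t - of_nat (Suc (Suc n)) = ?z' - 1" by simp_all
  have nz: "?z \<noteq> 0" "?z + 1 \<noteq> 0" "?z - 1 \<noteq> 0" "?z' \<noteq> 0" "?z' + 1 \<noteq> 0" "?z' - 1 \<noteq> 0"
    using lattice_nonzero[of m "Suc n"] lattice_nonzero[of m "Suc (Suc n)"] lattice_nonzero[of m n]
    by (simp_all add: algebra_simps)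
  have "d m n = (1 / ?z\<^sup>2 - 1 / ?z + 1 / (?z + 1)) + (1 / ?z'\<^sup>2 + 1 / ?z' - 1 / (?z' - 1))"
    unfolding d_def a_def B_def eq by simp
  then show ?thesis unfolding eq *(1)[OF nz(1-3)] *(2)[OF nz(4-6)] by simp
qed

lemma d_summable: "(\<lambda>(m, n). d m n) summable_on (UNIV \<times> UNIV)"
proof -
  define K where "K = 2 * ((Im t)\<^sup>2 / norm t) powr (-3/2)"
  have "norm (d m n) \<le> K * (real (Suc m) * real (Suc n)) powr (-3/2)" for m n
  proof -
    have "norm (d m n) \<le>
       norm (1 / ((of_nat (Suc m) * t + of_nat (Suc n))\<^sup>2 * (of_nat (Suc m) * t + of_nat (Suc (Suc n)))))
     + norm (1 / ((of_nat (Suc m) * t - of_nat (Suc n))\<^sup>2 * (of_nat (Suc m) * t - of_nat (Suc (Suc n)))))"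
      unfolding d_eq by (rule norm_triangle_ineq4)
    also have "\<dots> \<le> ((Im t)\<^sup>2 / norm t) powr (-3/2) * (real (Suc m) * real (Suc n)) powr (-3/2)
      + ((Im t)\<^sup>2 / norm t) powr (-3/2) * (real (Suc m) * real (Suc n)) powr (-3/2)"
      using norm_cubic_lattice_term_le[OF Im_pos, of "real (Suc m)" "real (Suc n)" "real (Suc n)" "real (Suc (Suc n))"]
        norm_cubic_lattice_term_le[OF Im_pos, of "real (Suc m)" "real (Suc n)" "- real (Suc n)" "- real (Suc (Suc n))"]
      by (intro add_mono) (simp_all del: of_nat_Suc)
    finally show ?thesis by (simp add: K_def mult_ac)
  qed
  then have "(\<lambda>x. norm (case x of (m, n) \<Rightarrow> d m n)) summable_on (UNIV \<times> UNIV)"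
    by (intro summable_on_comparison_test[OF summable_on_cmult_right[OF summable_on_powr_product, of K]])
       auto
  then show ?thesis by (rule abs_summable_summable)
qed

text \<open>The correction terms \<open>B m n - B m (n + 1)\<close> make the double series absolutely convergent,
  and they telescope in \<open>n\<close>; the two orders of summation therefore differ by \<open>lim C\<close>.\<close>

lemma iterated_sums_difference:
  assumes r: "\<And>m. a m sums r m" and c: "\<And>n. (\<lambda>m. a m n) sums c n"
    and Q: "r sums Q"
  shows "c sums (Q - \<i> * of_real pi / t)"
proof -
  have rows: "d m sums (r m - (B m 0 - 0))" for m
    unfolding d_def by (intro sums_diff r telescope_sums' B_tendsto)
  have cols: "(\<lambda>m. d m n) sums (c n - (C n - C (Suc n)))" for n
    unfolding d_def by (intro sums_diff c B_sums)
  obtain D where D: "(\<lambda>m. r m - (B m 0 - 0)) sums D" "(\<lambda>n. c n - (C n - C (Suc n))) sums D"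
    using iterated_sums_swap[OF d_summable rows cols] by blast
  \<comment> \<open>The boundary terms of the rows form column \<open>0\<close> of \<open>B\<close>,
    with sum \<open>C 0\<close>. The columns telescope to \<open>C 0\<close> minus the limit of
    \<open>C\<close>, so only that limit survives in the comparison.\<close>
  have "(\<lambda>m. r m - B m 0) sums (Q - C 0)" by (intro sums_diff Q B_sums)
  with D(1) have "D = Q - C 0" by (simp add: sums_unique2)
  moreover have "(\<lambda>n. c n - (C n - C (Suc n)) + (C n - C (Suc n))) sums (D + (C 0 - \<i> * of_real pi / t))"
    by (intro sums_add D(2) telescope_sums' C_tendsto)
  ultimately show ?thesis by simp
qed

lemma row_sums: "a m sums ((of_real pi / sin (of_real pi * (of_nat (Suc m) * t)))\<^sup>2 - 1 / (of_nat (Suc m) * t)\<^sup>2)"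
  unfolding a_def by (rule sin_inverse_square_partial_fractions[OF not_Ints(1)])

lemma col_sums:
  "(\<lambda>m. a m n) sums (((of_real pi / sin (of_real pi * (of_nat (Suc n) / t)))\<^sup>2 - 1 / (of_nat (Suc n) / t)\<^sup>2) / t\<^sup>2)"
proof -
  let ?w = "of_nat (Suc n) / t"
  have "(1 / (?w + of_nat (Suc m))\<^sup>2 + 1 / (?w - of_nat (Suc m))\<^sup>2) / t\<^sup>2 = a m n" for m
  proof -
    have w: "?w + of_nat (Suc m) = (of_nat (Suc m) * t + of_nat (Suc n)) / t"
      "?w - of_nat (Suc m) = - ((of_nat (Suc m) * t - of_nat (Suc n)) / t)"
      by (simp_all add: field_simps)
    have e: "1 / (z / t)\<^sup>2 / t\<^sup>2 = 1 / z\<^sup>2" "1 / (- (z / t))\<^sup>2 / t\<^sup>2 = 1 / z\<^sup>2" for z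
      by (simp_all add: field_simps)
    show ?thesis
      unfolding w a_def by (subst add_divide_distrib) (simp only: e)
  qed
  then show ?thesis
    using sums_divide[OF sin_inverse_square_partial_fractions[OF not_Ints(2)], of n "t\<^sup>2"] by simp
qed

end

text \<open>The axis \<open>n = 0\<close> contributes \<open>\<zeta>(2) / t^2\<close> to the rows
  and the axis \<open>m = 0\<close> contributes \<open>\<zeta>(2)\<close> to the columns.
  Multiplication by \<open>t^2\<close> turns the columns into the series at \<open>- 1 / t\<close>,
  the squared sine being even.\<close>

lemma eisenstein_weight_two_transformation:
  fixes t :: complex
  assumes t: "Im t > 0"
    and S: "(\<lambda>m. (of_real pi / sin (of_real pi * (of_nat (Suc m) * t)))\<^sup>2) sums G"
  shows "(\<lambda>m. (of_real pi / sin (of_real pi * (of_nat (Suc m) * (- 1 / t))))\<^sup>2)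
    sums (t\<^sup>2 * (G + of_real pi ^ 2 / 6) - of_real pi ^ 2 / 6 - \<i> * of_real pi * t)"
proof -
  interpret eisenstein_sums t by standard (rule t)
  have z: "(\<lambda>n. 1 / of_nat (Suc n) ^ 2) sums (of_real pi ^ 2 / 6 :: complex)"
    using sums_of_real[OF inverse_squares_sums, where 'a = complex] by simp
  have "(\<lambda>m. (of_real pi / sin (of_real pi * (of_nat (Suc m) * t)))\<^sup>2 - 1 / (of_nat (Suc m) * t)\<^sup>2)
      sums (G - of_real pi ^ 2 / 6 / t\<^sup>2)"
    using sums_diff[OF S sums_divide[OF z, of "t\<^sup>2"]] by (simp add: power_mult_distrib)
  from sums_mult[OF iterated_sums_difference[OF row_sums col_sums this], of "t\<^sup>2"]
  have "(\<lambda>n. (of_real pi / sin (of_real pi * (of_nat (Suc n) / t)))\<^sup>2 - 1 / (of_nat (Suc n) / t)\<^sup>2)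
      sums (t\<^sup>2 * (G - of_real pi ^ 2 / 6 / t\<^sup>2 - \<i> * of_real pi / t))"
    by simp
  from sums_add[OF this sums_mult[OF z, of "t\<^sup>2"]]
  have "(\<lambda>n. (of_real pi / sin (of_real pi * (of_nat (Suc n) / t)))\<^sup>2)
      sums (t\<^sup>2 * (G - of_real pi ^ 2 / 6 / t\<^sup>2 - \<i> * of_real pi / t) + t\<^sup>2 * (of_real pi ^ 2 / 6))"
    by (simp add: power_divide)
  moreover have "(of_real pi / sin (of_real pi * (of_nat (Suc m) * (- 1 / t))))\<^sup>2
      = (of_real pi / sin (of_real pi * (of_nat (Suc m) / t)))\<^sup>2" for m
  proof -
    have "of_real pi * (of_nat (Suc m) * (- 1 / t)) = - (of_real pi * (of_nat (Suc m) / t))" by simp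
    then show ?thesis by (simp only: sin_minus power_divide power2_minus)
  qed
  moreover have "t\<^sup>2 * (G - of_real pi ^ 2 / 6 / t\<^sup>2 - \<i> * of_real pi / t) + t\<^sup>2 * (of_real pi ^ 2 / 6)
      = t\<^sup>2 * (G + of_real pi ^ 2 / 6) - of_real pi ^ 2 / 6 - \<i> * of_real pi * t"
    by (simp add: field_simps power2_eq_square)
  ultimately show ?thesis by (simp only:)
qed

subsection \<open>The logarithm of the eta function\<close>

lemma upper_half_plane_iff [simp]: "t \<in> \<H> \<longleftrightarrow> Im t > 0"
  by (simp add: upper_half_plane_def)

lemma open_upper_half_plane: "open \<H>"
  unfolding upper_half_plane_def by (rule open_halfspace_Im_gt)

lemma convex_upper_half_plane: "convex \<H>"
  unfolding upper_half_plane_def by (rule convex_halfspace_Im_gt)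

lemma norm_nome: "norm (nome t) = exp (- 2 * pi * Im t)"
  by (simp add: nome_def)

lemma norm_nome_less_one: "Im t > 0 \<Longrightarrow> norm (nome t) < 1"
  by (simp add: norm_nome)

lemma nome_power: "nome t ^ k = nome (of_nat k * t)"
  by (simp add: nome_def exp_of_nat_mult[symmetric] mult_ac)

lemma norm_one_minus_power_ge:
  fixes q :: complex
  assumes "norm q \<le> r" "r < 1"
  shows "norm (1 - q ^ Suc n) \<ge> 1 - r"
proof -
  have "norm (q ^ Suc n) \<le> norm q"
    using assms by (simp add: norm_power norm_mult mult_left_le power_le_one)
  then show ?thesis using norm_triangle_ineq2[of 1 "q ^ Suc n"] assms by simp
qed

lemma one_minus_power_nonzero:
  fixes q :: complex
  assumes "norm q < 1"
  shows "1 - q ^ Suc n \<noteq> 0" "1 + q ^ Suc n \<noteq> 0"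
proof -
  have "norm (q ^ Suc n) < 1"
    using assms power_strict_mono[of "norm q" 1 "Suc n"] by (simp add: norm_power del: power_Suc)
  then show "1 - q ^ Suc n \<noteq> 0" "1 + q ^ Suc n \<noteq> 0"
    by (metis norm_one less_irrefl eq_iff_diff_eq_0) (metis \<open>norm (q ^ Suc n) < 1\<close> norm_one norm_minus_cancel less_irrefl add_eq_0_iff)
qed

lemma summable_geometric_Suc:
  fixes r :: real
  assumes "0 \<le> r" "r < 1"
  shows "summable (\<lambda>n. c * r ^ Suc n)"
  using assms by (intro summable_mult) (simp add: summable_geometric summable_mult)

text \<open>Minus the logarithm of Euler's product of the factors \<open>1 - q^k\<close>: expand the
  geometric series and sum over \<open>n\<close> before \<open>k\<close>. The series form needs no
  choice of branch.\<close>

definition lambert_log :: "complex \<Rightarrow> complex" where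
  "lambert_log t = (\<Sum>n. nome t ^ Suc n / (of_nat (Suc n) * (1 - nome t ^ Suc n)))"

text \<open>The generating function of the divisor sums. In this form its terms are, up to
  constants, both the derivatives of the terms of \<open>lambert_log\<close> and inverse squared
  sines.\<close>

definition lambert_deriv :: "complex \<Rightarrow> complex" where
  "lambert_deriv t = (\<Sum>n. nome t ^ Suc n / (1 - nome t ^ Suc n)\<^sup>2)"

text \<open>Keeping \<open>r\<close> apart from \<open>norm q\<close> makes the geometric majorant
  uniform, as needed for a bound on all of \<open>Im t \<ge> 1\<close>.\<close>

lemma norm_lambert_log_term_le:
  fixes q :: complex
  assumes "norm q \<le> r" "r < 1"
  shows "norm (q ^ Suc n / (of_nat (Suc n) * (1 - q ^ Suc n))) \<le> 1 / (1 - r) * r ^ Suc n"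
proof -
  have r: "0 \<le> r" using assms norm_ge_zero order_trans by blast
  have "norm (q ^ Suc n / (of_nat (Suc n) * (1 - q ^ Suc n))) = norm q ^ Suc n / (real (Suc n) * norm (1 - q ^ Suc n))"
    by (simp only: norm_divide norm_mult norm_power norm_of_nat)
  also have "\<dots> \<le> r ^ Suc n / (1 * (1 - r))"
    by (intro frac_le mult_mono power_mono norm_one_minus_power_ge assms) (use assms r in auto)
  finally show ?thesis by simp
qed

lemma norm_lambert_deriv_term_le:
  fixes q :: complex
  assumes "norm q \<le> r" "r < 1"
  shows "norm (q ^ Suc n / (1 - q ^ Suc n)\<^sup>2) \<le> 1 / (1 - r)\<^sup>2 * r ^ Suc n"
proof -
  have r: "0 \<le> r" using assms norm_ge_zero order_trans by blast
  have "norm (q ^ Suc n / (1 - q ^ Suc n)\<^sup>2) = norm q ^ Suc n / (norm (1 - q ^ Suc n))\<^sup>2"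
    by (simp only: norm_divide norm_mult norm_power norm_of_nat)
  also have "\<dots> \<le> r ^ Suc n / (1 - r)\<^sup>2"
    by (intro frac_le power_mono norm_one_minus_power_ge assms) (use assms r in auto)
  finally show ?thesis by simp
qed

lemma summable_lambert_log:
  fixes q :: complex
  assumes "norm q < 1"
  shows "summable (\<lambda>n. q ^ Suc n / (of_nat (Suc n) * (1 - q ^ Suc n)))"
  by (rule summable_comparison_test'[OF summable_geometric_Suc norm_lambert_log_term_le[OF order_refl]])
     (use assms in auto)

lemma summable_lambert_deriv:
  fixes q :: complex
  assumes "norm q < 1"
  shows "summable (\<lambda>n. q ^ Suc n / (1 - q ^ Suc n)\<^sup>2)"
  by (rule summable_comparison_test'[OF summable_geometric_Suc norm_lambert_deriv_term_le[OF order_refl]])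
     (use assms in auto)

lemma norm_lambert_log_le:
  assumes "Im t \<ge> 1"
  shows "norm (lambert_log t) \<le> (\<Sum>n. 1 / (1 - exp (- 2 * pi)) * exp (- 2 * pi) ^ Suc n)"
proof -
  have "norm (nome t) \<le> exp (- 2 * pi)" using assms by (simp add: norm_nome)
  then show ?thesis
    unfolding lambert_log_def
    by (intro norm_suminf_le summable_geometric_Suc norm_lambert_log_term_le) auto
qed

lemma has_field_derivative_nome [derivative_intros]:
  assumes "(f has_field_derivative D) (at x within A)"
  shows "((\<lambda>x. nome (f x)) has_field_derivative (2 * of_real pi * \<i> * D * nome (f x))) (at x within A)"
  unfolding nome_def by (rule derivative_eq_intros assms refl | simp)+

lemma lambert_log_has_field_derivative:
  assumes t: "Im t > 0"
  shows "(lambert_log has_field_derivative (2 * of_real pi * \<i> * lambert_deriv t)) (at t)"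
proof -
  \<comment> \<open>Termwise differentiation needs a uniform majorant; above half the height of
    \<open>t\<close> the nome stays within \<open>r < 1\<close>.\<close>
  define e where "e = Im t / 2"
  define r where "r = exp (- 2 * pi * e)"
  have r: "0 \<le> r" "r < 1" using t by (auto simp: r_def e_def)
  define S where "S = {z. Im z > e}"
  have S: "norm (nome z) \<le> r" "norm (nome z) < 1" if "z \<in> S" for z
    using that t by (auto simp: S_def norm_nome r_def e_def)
  have "open S" unfolding S_def by (rule open_halfspace_Im_gt)
  have tS: "t \<in> S" using t by (simp add: S_def e_def)
  let ?f = "\<lambda>n z. nome z ^ Suc n / (of_nat (Suc n) * (1 - nome z ^ Suc n))"
  let ?f' = "\<lambda>n z. 2 * of_real pi * \<i> * (nome z ^ Suc n / (1 - nome z ^ Suc n)\<^sup>2)"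
  have "((\<lambda>z. \<Sum>n. ?f n z) has_field_derivative (\<Sum>n. ?f' n t)) (at t)"
  proof (rule has_field_derivative_series'(2)[of S _ _ t])
    show "convex S" unfolding S_def by (rule convex_halfspace_Im_gt)
    show "(?f n has_field_derivative ?f' n z) (at z within S)" if "z \<in> S" for n z
    proof -
      have nz: "1 - nome (of_nat (Suc n) * z) \<noteq> 0"
        using one_minus_power_nonzero(1)[OF S(2)[OF that], of n] by (simp only: nome_power) simp
      define c :: complex where "c = of_nat (Suc n)"
      have c: "c \<noteq> 0" unfolding c_def using of_nat_neq_0 by blast
      have "((\<lambda>z. nome (c * z) / (c * (1 - nome (c * z)))) has_field_derivative
          2 * of_real pi * \<i> * (nome (c * z) / (1 - nome (c * z))\<^sup>2)) (at z within S)"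
        using nz c unfolding c_def[symmetric]
        by (auto intro!: derivative_eq_intros simp: power2_eq_square divide_simps) (simp add: algebra_simps)
      then show ?thesis unfolding nome_power c_def .
    qed
    show "uniformly_convergent_on S (\<lambda>n z. \<Sum>i<n. ?f' i z)"
    proof (rule Weierstrass_m_test')
      show "norm (?f' n z) \<le> 2 * pi / (1 - r)\<^sup>2 * r ^ Suc n" if "z \<in> S" for n z
        using mult_left_mono[OF norm_lambert_deriv_term_le[OF S(1)[OF that] r(2), of n], of "2 * pi"]
        by (simp only: norm_mult norm_numeral norm_of_real norm_ii abs_of_pos[OF pi_gt_zero]) simp
      show "summable (\<lambda>n. 2 * pi / (1 - r)\<^sup>2 * r ^ Suc n)"
        by (intro summable_geometric_Suc r)
    qed
    show "summable (\<lambda>n. ?f n t)" by (intro summable_lambert_log S tS)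
    show "t \<in> interior S" using tS \<open>open S\<close> by (simp add: interior_open)
  qed (rule tS)
  then show ?thesis
    unfolding lambert_log_def[abs_def] lambert_deriv_def
    by (simp only: suminf_mult[OF summable_lambert_deriv[OF S(2)[OF tS]]])
qed

section \<open>Inversion of the Lambert series and of the logarithm of eta\<close>

lemma inverse_sin_square_nome:
  "(of_real pi / sin (of_real pi * t))\<^sup>2 = - 4 * of_real pi ^ 2 * (nome t / (1 - nome t)\<^sup>2)"
proof -
  let ?e = "exp (\<i> * (of_real pi * t))"
  have n: "nome t = ?e\<^sup>2"
    by (simp add: nome_def exp_double[symmetric] mult_ac)
  have "sin (of_real pi * t) = (?e - inverse ?e) / (2 * \<i>)"
    by (simp add: sin_exp_eq exp_minus)
  also have "\<dots> = (?e\<^sup>2 - 1) / (2 * \<i> * ?e)"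
    by (simp add: field_simps power2_eq_square)
  finally have s: "sin (of_real pi * t) = (nome t - 1) / (2 * \<i> * ?e)" unfolding n .
  \<comment> \<open>No case distinction at integers: there \<open>nome t = 1\<close>, and division
    by zero makes both sides \<open>0\<close>.\<close>
  have "(of_real pi / sin (of_real pi * t))\<^sup>2 = of_real pi ^ 2 * (2 * \<i> * ?e)\<^sup>2 / (nome t - 1)\<^sup>2"
    unfolding s by (simp add: power_divide power_mult_distrib)
  also have "(2 * \<i> * ?e)\<^sup>2 = - 4 * nome t"
    by (simp add: n power_mult_distrib)
  finally show ?thesis by (simp add: power2_commute)
qed

lemma lambert_deriv_sums:
  assumes "Im t > 0"
  shows "(\<lambda>n. nome t ^ Suc n / (1 - nome t ^ Suc n)\<^sup>2) sums lambert_deriv t"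
  unfolding lambert_deriv_def
  by (rule summable_sums[OF summable_lambert_deriv[OF norm_nome_less_one[OF assms]]])

lemma inverse_sin_square_sums:
  assumes "Im t > 0"
  shows "(\<lambda>m. (of_real pi / sin (of_real pi * (of_nat (Suc m) * t)))\<^sup>2) sums (- 4 * of_real pi ^ 2 * lambert_deriv t)"
  unfolding inverse_sin_square_nome nome_power[symmetric]
  by (rule sums_mult[OF lambert_deriv_sums[OF assms]])

lemma Im_minus_inverse: "Im (- 1 / t) = Im t / (norm t)\<^sup>2"
  by (simp add: Im_divide cmod_power2)

text \<open>The constants come from dividing by \<open>-4 * \<pi>^2\<close>. In classical terms
  \<open>lambert_deriv - 1 / 24\<close> is \<open>- E_2 / 24\<close>, and this is the
  quasi-modularity of \<open>E_2\<close>.\<close>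

lemma lambert_deriv_inversion:
  assumes t: "Im t > 0"
  shows "lambert_deriv (- 1 / t) = t\<^sup>2 * (lambert_deriv t - 1 / 24) + 1 / 24 + \<i> * t / (4 * of_real pi)"
proof -
  have i: "Im (- 1 / t) > 0" using t unfolding Im_minus_inverse by (auto intro!: divide_pos_pos)
  have "- 4 * of_real pi ^ 2 * lambert_deriv (- 1 / t)
      = t\<^sup>2 * (- 4 * of_real pi ^ 2 * lambert_deriv t + of_real pi ^ 2 / 6) - of_real pi ^ 2 / 6 - \<i> * of_real pi * t"
    using sums_unique2[OF inverse_sin_square_sums[OF i]
        eisenstein_weight_two_transformation[OF t inverse_sin_square_sums[OF t]]] .
  also have "\<dots> = - 4 * of_real pi ^ 2 * (t\<^sup>2 * (lambert_deriv t - 1 / 24) + 1 / 24 + \<i> * t / (4 * of_real pi))"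
    by (simp add: field_simps power2_eq_square)
  finally show ?thesis by simp
qed

definition log_eta :: "complex \<Rightarrow> complex" where
  "log_eta t = of_real pi * \<i> * t / 12 - lambert_log t"

lemma log_eta_has_field_derivative:
  assumes "Im t > 0"
  shows "(log_eta has_field_derivative (of_real pi * \<i> / 12 - 2 * of_real pi * \<i> * lambert_deriv t)) (at t)"
  unfolding log_eta_def[abs_def]
  by (rule derivative_eq_intros lambert_log_has_field_derivative assms refl | simp)+

text \<open>The defect \<open>\<i> * t / (4 * \<pi>)\<close>, multiplied by
  \<open>-2 * \<pi> * \<i> / t^2\<close>, becomes \<open>1 / (2 * t)\<close>, the derivative of
  \<open>Ln (- \<i> * t) / 2\<close>. The principal branch is holomorphic here because
  \<open>- \<i> * t\<close> has positive real part.\<close>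

lemma log_eta_inversion:
  assumes t: "Im t > 0"
  shows "log_eta (- 1 / t) = log_eta t + Ln (- \<i> * t) / 2"
proof -
  have "((\<lambda>t. log_eta (- 1 / t) - log_eta t - Ln (- \<i> * t) / 2) has_field_derivative 0) (at z within \<H>)"
    if "z \<in> \<H>" for z
  proof -
    from that have z: "Im z > 0" by simp
    then have z0: "z \<noteq> 0" by auto
    have i: "Im (- 1 / z) > 0" using z unfolding Im_minus_inverse by (auto intro!: divide_pos_pos)
    have nr: "- \<i> * z \<notin> \<real>\<^sub>\<le>\<^sub>0" using z by (auto simp: complex_nonpos_Reals_iff)
    have inv: "((\<lambda>t. - 1 / t) has_field_derivative 1 / z\<^sup>2) (at z)"
      using z0 by (auto intro!: derivative_eq_intros simp: power2_eq_square)
    have "((\<lambda>t. log_eta (- 1 / t) - log_eta t - Ln (- \<i> * t) / 2) has_field_derivative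
      (of_real pi * \<i> / 12 - 2 * of_real pi * \<i> * lambert_deriv (- 1 / z)) * (1 / z\<^sup>2)
      - (of_real pi * \<i> / 12 - 2 * of_real pi * \<i> * lambert_deriv z) - inverse (- \<i> * z) * (- \<i>) / 2) (at z)"
      by (intro DERIV_diff DERIV_cdivide DERIV_chain2[OF log_eta_has_field_derivative[OF i] inv]
            log_eta_has_field_derivative[OF z] DERIV_chain2[where f = Ln and g = "\<lambda>t. - \<i> * t", OF has_field_derivative_Ln[OF nr]])
         (auto intro!: derivative_eq_intros)
    also have "(of_real pi * \<i> / 12 - 2 * of_real pi * \<i> * lambert_deriv (- 1 / z)) * (1 / z\<^sup>2)
      - (of_real pi * \<i> / 12 - 2 * of_real pi * \<i> * lambert_deriv z) - inverse (- \<i> * z) * (- \<i>) / 2 = 0"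
      unfolding lambert_deriv_inversion[OF z] using z0
      by (simp add: field_simps power2_eq_square)
    finally show ?thesis by (rule has_field_derivative_at_within)
  qed
  then obtain c where c: "\<And>z. z \<in> \<H> \<Longrightarrow> log_eta (- 1 / z) - log_eta z - Ln (- \<i> * z) / 2 = c"
    using has_field_derivative_zero_constant[OF convex_upper_half_plane, of "\<lambda>t. log_eta (- 1 / t) - log_eta t - Ln (- \<i> * t) / 2"]
    by blast
  have "- 1 / \<i> = \<i>" by (simp add: divide_complex_def)
  then have "c = 0" using c[of \<i>] by simp
  then show ?thesis using c[of t] t by (simp add: algebra_simps)
qed

subsection \<open>Modularity and growth\<close>

definition log_eta_height :: "complex \<Rightarrow> real" where
  "log_eta_height t = ln (Im t) / 4 + Re (log_eta t)"

lemma nome_plus_of_int: "nome (t + of_int k) = nome t"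
proof -
  have "nome (t + of_int k) = exp (2 * of_real pi * \<i> * t + \<i> * (of_int k * (of_real pi * 2)))"
    by (simp add: nome_def algebra_simps)
  also have "\<dots> = nome t"
    unfolding nome_def by (subst exp_eq) (auto intro!: exI[of _ k] simp: algebra_simps)
  finally show ?thesis .
qed

text \<open>Translation adds the imaginary number \<open>\<pi> * \<i> * k / 12\<close> to
  \<open>log_eta\<close>, which the real part removes.\<close>

lemma log_eta_height_plus_of_int: "log_eta_height (t + of_int k) = log_eta_height t"
  by (simp add: log_eta_height_def log_eta_def lambert_log_def nome_plus_of_int)

text \<open>\<open>Re (log_eta t)\<close> gains half of \<open>ln (norm t)\<close>, while a quarter
  of \<open>ln (Im t)\<close> loses the same amount.\<close>

lemma log_eta_height_inversion:
  assumes t: "Im t > 0"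
  shows "log_eta_height (- 1 / t) = log_eta_height t"
proof -
  have t0: "t \<noteq> 0" using t by auto
  have "Re (Ln (- \<i> * t)) = ln (norm t)" using t0 by (simp add: Re_Ln norm_mult)
  moreover have "ln (Im (- 1 / t)) = ln (Im t) - 2 * ln (norm t)"
    unfolding Im_minus_inverse using t t0 by (simp add: ln_div ln_realpow)
  ultimately show ?thesis
    unfolding log_eta_height_def log_eta_inversion[OF t] by (simp add: field_simps)
qed

section \<open>Invariance of the height under the full modular group\<close>

lemma moebius_denominator_nonzero:
  fixes a b c d :: int
  assumes "a * d - b * c = 1" "Im t > 0"
  shows "of_int c * t + of_int d \<noteq> 0"
  using assms by (auto simp: complex_eq_iff)

lemma Im_moebius_transform:
  fixes a b c d :: int
  assumes "a * d - b * c = 1"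
  shows "Im ((of_int a * t + of_int b) / (of_int c * t + of_int d)) = Im t / (norm (of_int c * t + of_int d))\<^sup>2"
proof -
  have "real_of_int a * of_int d - of_int b * of_int c = 1"
    using assms by (metis of_int_1 of_int_diff of_int_mult)
  then have "of_int a * Im t * of_int d = Im t + of_int b * of_int c * Im t"
    by (metis (no_types, opaque_lifting) add.commute diff_add_cancel distrib_right mult.assoc mult.commute mult_1)
  then show ?thesis
    by (simp add: Im_divide cmod_power2 algebra_simps)
qed

lemma Im_moebius_transform_pos:
  fixes a b c d :: int
  assumes "a * d - b * c = 1" "Im t > 0"
  shows "Im ((of_int a * t + of_int b) / (of_int c * t + of_int d)) > 0"
  using Im_moebius_transform[OF assms(1), of t] moebius_denominator_nonzero[OF assms] assms(2)
  by (simp add: zero_less_divide_iff)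

text \<open>Euclid's algorithm on the left column: translating by \<open>a div c\<close> and inverting replaces
  \<open>c\<close> by \<open>a mod c\<close>.\<close>

lemma log_eta_height_moebius:
  fixes a b c d :: int
  assumes "a * d - b * c = 1" "Im t > 0"
  shows "log_eta_height ((of_int a * t + of_int b) / (of_int c * t + of_int d)) = log_eta_height t"
  using assms(1)
proof (induction "nat \<bar>c\<bar>" arbitrary: a b c d rule: less_induct)
  case less
  show ?case
  proof (cases "c = 0")
    case True
    then have "(a = 1 \<and> d = 1) \<or> (a = -1 \<and> d = -1)"
      using less.prems by (simp add: zmult_eq_1_iff)
    then show ?thesis
      using True log_eta_height_plus_of_int[of t b] log_eta_height_plus_of_int[of t "- b"] by auto
  next
    case False
    define k where "k = a div c"
    define a' b' where "a' = a - k * c" and "b' = b - k * d"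
    let ?z = "(of_int a * t + of_int b) / (of_int c * t + of_int d) :: complex"
    have nz: "of_int c * t + of_int d \<noteq> 0" by (rule moebius_denominator_nonzero[OF less.prems assms(2)])
    have "a' = a mod c" by (simp add: a'_def k_def minus_div_mult_eq_mod)
    then have lt: "nat \<bar>a'\<bar> < nat \<bar>c\<bar>" using False abs_mod_less[of c a] by simp
    have det: "- c * b' - (- d) * a' = 1"
      using less.prems by (simp add: a'_def b'_def algebra_simps)
    have sub: "?z - of_int k = (of_int a' * t + of_int b') / (of_int c * t + of_int d)"
      using nz by (simp add: a'_def b'_def field_simps)
    then have inv: "- 1 / (?z - of_int k) = (of_int (- c) * t + of_int (- d)) / (of_int a' * t + of_int b')"
      using nz by simp
    have pos: "Im (?z - of_int k) > 0"
      using Im_moebius_transform_pos[OF less.prems assms(2)] by simp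
    have "log_eta_height ?z = log_eta_height (?z - of_int k)"
      using log_eta_height_plus_of_int[of "?z" "- k"] by simp
    also have "\<dots> = log_eta_height (- 1 / (?z - of_int k))"
      by (rule log_eta_height_inversion[OF pos, symmetric])
    also have "\<dots> = log_eta_height t"
      unfolding inv by (rule less.hyps[OF lt]) (use det in simp)
    finally show ?thesis .
  qed
qed

section \<open>Expressing the completed function through the height\<close>

lemma nome_double: "nome (2 * t) = (nome t)\<^sup>2"
  using nome_power[of t 2] by simp

lemma g1_nome_sums:
  assumes t: "Im t > 0"
  shows "(\<lambda>n. nome t ^ Suc n / (of_nat (Suc n) * (1 + nome t ^ Suc n)))
    sums (lambert_log t - 2 * lambert_log (2 * t))"
proof -
  have t2: "Im (2 * t) > 0" using t by simp
  have q: "norm (nome t) < 1" "norm (nome (2 * t)) < 1"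
    using norm_nome_less_one[OF t] norm_nome_less_one[OF t2] .
  have *: "x / (N * (1 - x)) - 2 * (x\<^sup>2 / (N * (1 - x\<^sup>2))) = x / (N * (1 + x))"
    if "1 - x \<noteq> 0" "1 + x \<noteq> 0" "N \<noteq> 0" for x N :: complex
  proof -
    have x2: "1 - x\<^sup>2 = (1 - x) * (1 + x)" by (simp add: power2_eq_square algebra_simps)
    show ?thesis unfolding x2 using that by (simp add: divide_simps) (simp add: algebra_simps power2_eq_square)
  qed
  have "(\<lambda>n. nome t ^ Suc n / (of_nat (Suc n) * (1 - nome t ^ Suc n))
     - 2 * (nome (2 * t) ^ Suc n / (of_nat (Suc n) * (1 - nome (2 * t) ^ Suc n))))
    sums (lambert_log t - 2 * lambert_log (2 * t))"
    unfolding lambert_log_def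
    by (intro sums_diff sums_mult summable_sums summable_lambert_log q)
  moreover have "nome t ^ Suc n / (of_nat (Suc n) * (1 - nome t ^ Suc n))
     - 2 * (nome (2 * t) ^ Suc n / (of_nat (Suc n) * (1 - nome (2 * t) ^ Suc n)))
     = nome t ^ Suc n / (of_nat (Suc n) * (1 + nome t ^ Suc n))" for n
  proof -
    have "nome (2 * t) ^ Suc n = (nome t ^ Suc n)\<^sup>2"
      by (simp only: nome_double flip: power_mult) (simp only: mult.commute)
    then show ?thesis
      using *[OF one_minus_power_nonzero[OF q(1), of n] of_nat_neq_0[of n]] by (simp only:)
  qed
  ultimately show ?thesis by (simp only:)
qed

lemma g1_nome:
  assumes "Im t > 0"
  shows "g1 (nome t) = lambert_log t - 2 * lambert_log (2 * t)"
  using g1_nome_sums[OF assms] unfolding g1_def by (simp add: sums_iff)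

lemma g1_cnj_nome:
  assumes "Im t > 0"
  shows "g1 (cnj (nome t)) = cnj (lambert_log t - 2 * lambert_log (2 * t))"
proof -
  have "(\<lambda>n. cnj (nome t ^ Suc n / (of_nat (Suc n) * (1 + nome t ^ Suc n))))
      sums cnj (lambert_log t - 2 * lambert_log (2 * t))"
    using g1_nome_sums[OF assms] by (simp only: sums_cnj)
  then show ?thesis unfolding g1_def by (simp add: sums_iff)
qed

text \<open>The Lambert parts dictate the coefficients \<open>4\<close> and \<open>-2\<close>, and
  the completion then fits: \<open>ln v\<close> gets \<open>1 - 1/2 = 1/2\<close>, and
  \<open>v\<close> gets \<open>- 2 * \<pi> / 3 + \<pi> / 6 = - \<pi> / 2\<close>. One of the two
  \<open>ln 2\<close> comes from \<open>ln (2 * v)\<close>.\<close>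

lemma g1_hat_eq_log_eta_height:
  obtains c where "\<And>t. Im t > 0 \<Longrightarrow> g1_hat t = c + of_real (4 * log_eta_height (2 * t) - 2 * log_eta_height t)"
proof
  fix t assume t: "Im t > 0"
  define G where "G = lambert_log t - 2 * lambert_log (2 * t)"
  have "G + cnj G = of_real (2 * Re (lambert_log t) - 4 * Re (lambert_log (2 * t)))"
    by (simp add: complex_eq_iff G_def)
  moreover have "4 * log_eta_height (2 * t) - 2 * log_eta_height t = ln 2 + ln (Im t) / 2 - pi / 2 * Im t
      + (2 * Re (lambert_log t) - 4 * Re (lambert_log (2 * t)))"
    using t by (simp add: log_eta_height_def log_eta_def ln_mult field_simps)
  moreover have "g1_hat t = (of_real (ln 2) - euler_mascheroni + 6 * deriv Riemann_zeta 2 / of_real pi ^ 2)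
      + of_real (ln 2 + ln (Im t) / 2 - pi / 2 * Im t) + (G + cnj G)"
    unfolding g1_hat_def g1_nome[OF t] g1_cnj_nome[OF t] G_def by (simp add: algebra_simps)
  ultimately show "g1_hat t = (of_real (ln 2) - euler_mascheroni + 6 * deriv Riemann_zeta 2 / of_real pi ^ 2)
      + of_real (4 * log_eta_height (2 * t) - 2 * log_eta_height t)"
    by (simp only: of_real_add add.assoc)
qed

text \<open>Conjugation by \<open>diag(2, 1)\<close> doubles \<open>b\<close> and halves
  \<open>c\<close>; evenness of \<open>c\<close> keeps the matrix integral.\<close>

lemma log_eta_height_double_Gamma0:
  fixes a b c d :: int
  assumes "a * d - b * c = 1" "even c" "Im t > 0"
  shows "log_eta_height (2 * ((of_int a * t + of_int b) / (of_int c * t + of_int d))) = log_eta_height (2 * t)"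
proof -
  obtain c' where c: "c = 2 * c'" using assms(2) by blast
  have "log_eta_height ((of_int a * (2 * t) + of_int (2 * b)) / (of_int c' * (2 * t) + of_int d)) = log_eta_height (2 * t)"
    by (rule log_eta_height_moebius) (use assms c in simp_all)
  moreover have "(of_int a * (2 * t) + of_int (2 * b)) / (of_int c' * (2 * t) + of_int d)
    = 2 * ((of_int a * t + of_int b) / (of_int c * t + of_int d))"
    by (simp add: c algebra_simps)
  ultimately show ?thesis by simp
qed

text \<open>An integral matrix of determinant \<open>2\<close> is an element of
  \<open>SL_2(Z)\<close> times an upper triangular one, whose action is affine with positive slope.
  At a cusp the doubled argument therefore still tends to infinity inside the height.\<close>

lemma log_eta_height_double_moebius:
  fixes a b c d :: int
  assumes det: "a * d - b * c = 1"
  obtains \<kappa> \<beta> :: real where "\<kappa> > 0"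
    "\<And>t. Im t > 0 \<Longrightarrow> log_eta_height (2 * ((of_int a * t + of_int b) / (of_int c * t + of_int d)))
      = log_eta_height (of_real \<kappa> * t + of_real \<beta>)"
proof (cases "even c")
  case True
  then show ?thesis
    using that[of 2 0] log_eta_height_double_Gamma0[OF det] by simp
next
  case odd: False
  \<comment> \<open>With \<open>c\<close> odd, this \<open>s\<close> makes \<open>d - s * c\<close>
    even, so that \<open>(2a, 2b; c, d)\<close> factors as \<open>(2a, b - s a; c, e)\<close> times
    \<open>(1, s; 0, 2)\<close>.\<close>
  define s :: int where "s = (if even d then 0 else 1)"
  have "even (d - s * c)" using odd by (auto simp: s_def)
  then obtain e where e: "d - s * c = 2 * e" by blast
  have "a * (d - s * c) - (b - s * a) * c = 1" using det by (simp add: algebra_simps)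
  then have det': "2 * a * e - (b - s * a) * c = 1" unfolding e by (simp add: algebra_simps)
  show ?thesis
  proof (rule that[of "1 / 2" "of_int s / 2"])
    fix t assume t: "Im t > 0"
    define w where "w = (t + of_int s) / 2"
    have "2 * w = t + of_int s" unfolding w_def by simp
    then have tw: "t = 2 * w - of_int s" by simp
    have w: "Im w > 0" using t by (simp add: w_def)
    have d: "(of_int d :: complex) = 2 * of_int e + of_int s * of_int c"
      using e by (metis add.commute diff_add_cancel of_int_add of_int_mult of_int_numeral)
    have "of_int c * t + of_int d = 2 * (of_int c * w + of_int e)"
      unfolding d tw by (simp add: algebra_simps)
    moreover have "of_int a * t + of_int b = of_int (2 * a) * w + of_int (b - s * a)"
      unfolding tw by (simp add: algebra_simps)
    moreover have "2 * (x / (2 * y)) = x / y" for x y :: complex by simp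
    ultimately have "2 * ((of_int a * t + of_int b) / (of_int c * t + of_int d))
        = (of_int (2 * a) * w + of_int (b - s * a)) / (of_int c * w + of_int e)"
      by (simp only:)
    then have "log_eta_height (2 * ((of_int a * t + of_int b) / (of_int c * t + of_int d))) = log_eta_height w"
      by (simp only: log_eta_height_moebius[OF det' w])
    also have "w = of_real (1 / 2) * t + of_real (of_int s / 2)" by (simp add: w_def field_simps)
    finally show "log_eta_height (2 * ((of_int a * t + of_int b) / (of_int c * t + of_int d)))
      = log_eta_height (of_real (1 / 2) * t + of_real (of_int s / 2))" .
  qed simp
qed

section \<open>Growth at the cusps and invariance under the congruence subgroup\<close>

lemma log_eta_height_linear_bound:
  obtains K where "K \<ge> 0" "\<And>t. Im t \<ge> 1 \<Longrightarrow> \<bar>log_eta_height t\<bar> \<le> Im t + K"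
proof -
  define K where "K = (\<Sum>n. 1 / (1 - exp (- 2 * pi)) * exp (- 2 * pi) ^ Suc n)"
  have K: "norm (lambert_log t) \<le> K" if "Im t \<ge> 1" for t
    unfolding K_def by (rule norm_lambert_log_le[OF that])
  have "\<bar>log_eta_height t\<bar> \<le> Im t + K" if t: "Im t \<ge> 1" for t
  proof -
    have "\<bar>Re (lambert_log t)\<bar> \<le> K" using abs_Re_le_cmod[of "lambert_log t"] K[OF t] by linarith
    moreover have "0 \<le> ln (Im t)" "ln (Im t) \<le> Im t" using t ln_le_minus_one[of "Im t"] by auto
    moreover have "pi * Im t \<le> 4 * Im t" using t pi_less_4 by simp
    moreover have "0 \<le> pi * Im t" using t by simp
    moreover have "log_eta_height t = ln (Im t) / 4 - pi * Im t / 12 - Re (lambert_log t)"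
      by (simp add: log_eta_height_def log_eta_def)
    ultimately show ?thesis using t by linarith
  qed
  moreover have "K \<ge> 0" using order_trans[OF norm_ge_zero K[of \<i>]] by simp
  ultimately show ?thesis by (rule that[rotated])
qed

lemma Gamma0_subset_SL2Z: "A \<in> Gamma0 N \<Longrightarrow> A \<in> SL2Z"
  by (simp add: Gamma0_def)

lemma SL2Z_det: "A \<in> SL2Z \<Longrightarrow> A $ 1 $ 1 * A $ 2 $ 2 - A $ 1 $ 2 * A $ 2 $ 1 = 1"
  by (simp add: SL2Z_def det_2)

lemma g1_hat_moebius:
  assumes A: "A \<in> Gamma0 2" and t: "Im t > 0"
  shows "g1_hat (moebius A t) = g1_hat t"
proof -
  note det = SL2Z_det[OF Gamma0_subset_SL2Z[OF A]]
  have "even (A $ 2 $ 1)" using A by (simp add: Gamma0_def)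
  note h = log_eta_height_double_Gamma0[OF det this t] log_eta_height_moebius[OF det t]
  obtain c where c: "\<And>t. Im t > 0 \<Longrightarrow> g1_hat t = c + of_real (4 * log_eta_height (2 * t) - 2 * log_eta_height t)"
    by (rule g1_hat_eq_log_eta_height) blast
  show ?thesis
    unfolding moebius_def c[OF Im_moebius_transform_pos[OF det t]] c[OF t] h ..
qed

lemma g1_hat_growth: "linear_exponential_growth_at_cusps 0 g1_hat"
  unfolding linear_exponential_growth_at_cusps_def
proof
  fix A assume "A \<in> SL2Z"
  note det = SL2Z_det[OF this]
  obtain c where c: "\<And>t. Im t > 0 \<Longrightarrow> g1_hat t = c + of_real (4 * log_eta_height (2 * t) - 2 * log_eta_height t)"
    by (rule g1_hat_eq_log_eta_height) blast
  obtain \<kappa> \<beta> :: real where \<kappa>: "\<kappa> > 0" and h2: "\<And>t. Im t > 0 \<Longrightarrow> log_eta_height (2 * moebius A t)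
      = log_eta_height (of_real \<kappa> * t + of_real \<beta>)"
    unfolding moebius_def by (rule log_eta_height_double_moebius[OF det]) blast
  obtain K where K: "K \<ge> 0" "\<And>t. Im t \<ge> 1 \<Longrightarrow> \<bar>log_eta_height t\<bar> \<le> Im t + K"
    by (rule log_eta_height_linear_bound) blast
  define M where "M = norm c + 4 * \<kappa> + 2 + 6 * K"
  \<comment> \<open>The threshold puts both \<open>t\<close> and
    \<open>\<kappa> * t + \<beta>\<close> at height at least \<open>1\<close>, where the linear
    bound applies.\<close>
  have bound: "norm (g1_hat (moebius A t)) \<le> M * exp (Im t)" if t: "Im t \<ge> max 1 (1 / \<kappa>)" for t
  proof -
    have t1: "Im t \<ge> 1" "Im t > 0" using t by auto
    have "\<kappa> * Im t \<ge> 1" using t \<kappa> by (simp add: field_simps)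
    then have b1: "\<bar>log_eta_height (2 * moebius A t)\<bar> \<le> \<kappa> * Im t + K"
      using K(2)[of "of_real \<kappa> * t + of_real \<beta>"] by (simp add: h2[OF t1(2)])
    have b2: "\<bar>log_eta_height (moebius A t)\<bar> \<le> Im t + K"
      using K(2)[OF t1(1)] by (simp add: moebius_def log_eta_height_moebius[OF det t1(2)])
    have "norm (g1_hat (moebius A t)) \<le> norm c + \<bar>4 * log_eta_height (2 * moebius A t) - 2 * log_eta_height (moebius A t)\<bar>"
      using c[of "moebius A t"] Im_moebius_transform_pos[OF det t1(2)] norm_triangle_ineq[of c] norm_of_real
      unfolding moebius_def by metis
    also have "\<dots> \<le> (norm c + 6 * K) * 1 + (4 * \<kappa> + 2) * Im t"
      using b1 b2 by (simp add: algebra_simps)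
    also have "\<dots> \<le> (norm c + 6 * K) * exp (Im t) + (4 * \<kappa> + 2) * exp (Im t)"
    proof (intro add_mono mult_left_mono)
      show "Im t \<le> exp (Im t)" using exp_ge_add_one_self[of "Im t"] by linarith
    qed (use K(1) \<kappa> t1 in auto)
    finally show ?thesis by (simp add: M_def algebra_simps)
  qed
  have "(\<lambda>t. norm (automorphy_factor A t powi (- 0) * g1_hat (moebius A t)))
      \<in> O[filtercomap Im at_top](\<lambda>t. exp (1 * Im t))"
  proof (rule bigoI[where c = M])
    show "\<forall>\<^sub>F t in filtercomap Im at_top.
        norm (norm (automorphy_factor A t powi (- 0) * g1_hat (moebius A t))) \<le> M * norm (exp (1 * Im t))"
      unfolding eventually_filtercomap_at_top_linorder
      using bound by (intro exI[of _ "max 1 (1 / \<kappa>)"]) auto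
  qed
  then show "\<exists>C. (\<lambda>t. norm (automorphy_factor A t powi (- 0) * g1_hat (moebius A t)))
      \<in> O[filtercomap Im at_top](\<lambda>t. exp (C * Im t))" by blast
qed

subsection \<open>Real-analytic functions\<close>

lemma real_analytic_onI:
  assumes "\<And>z. z \<in> S \<Longrightarrow> \<exists>r>0. \<exists>a :: nat \<Rightarrow> nat \<Rightarrow> complex. \<forall>x y :: real. \<bar>x\<bar> < r \<longrightarrow> \<bar>y\<bar> < r \<longrightarrow>
        ((\<lambda>(m, n). a m n * of_real x ^ m * of_real y ^ n) has_sum f (z + Complex x y)) UNIV"
  shows "f real_analytic_on S"
  using assms unfolding real_analytic_on_def by blast

lemma real_analytic_on_add:
  assumes "f real_analytic_on S" "g real_analytic_on S"
  shows "(\<lambda>z. f z + g z) real_analytic_on S"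
proof (rule real_analytic_onI)
  fix z assume z: "z \<in> S"
  obtain r a where r: "r > 0" and a: "\<And>x y. \<bar>x\<bar> < r \<Longrightarrow> \<bar>y\<bar> < r \<Longrightarrow>
      ((\<lambda>(m, n). a m n * of_real x ^ m * of_real y ^ n) has_sum f (z + Complex x y)) UNIV"
    using assms(1) z unfolding real_analytic_on_def by meson
  obtain s b where s: "s > 0" and b: "\<And>x y. \<bar>x\<bar> < s \<Longrightarrow> \<bar>y\<bar> < s \<Longrightarrow>
      ((\<lambda>(m, n). b m n * of_real x ^ m * of_real y ^ n) has_sum g (z + Complex x y)) UNIV"
    using assms(2) z unfolding real_analytic_on_def by meson
  have "((\<lambda>(m, n). (a m n + b m n) * of_real x ^ m * of_real y ^ n) has_sum (f (z + Complex x y) + g (z + Complex x y))) UNIV"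
    if "\<bar>x\<bar> < min r s" "\<bar>y\<bar> < min r s" for x y
    using has_sum_add[OF a[of x y] b[of x y]] that by (simp add: case_prod_unfold algebra_simps)
  then show "\<exists>r>0. \<exists>a. \<forall>x y. \<bar>x\<bar> < r \<longrightarrow> \<bar>y\<bar> < r \<longrightarrow>
        ((\<lambda>(m, n). a m n * of_real x ^ m * of_real y ^ n) has_sum f (z + Complex x y) + g (z + Complex x y)) UNIV"
    using r s by (intro exI[of _ "min r s"] conjI exI[of _ "\<lambda>m n. a m n + b m n"] allI impI) auto
qed

lemma real_analytic_on_cnj:
  assumes "f real_analytic_on S"
  shows "(\<lambda>z. cnj (f z)) real_analytic_on S"
proof (rule real_analytic_onI)
  fix z assume z: "z \<in> S"
  obtain r a where r: "r > 0" and a: "\<And>x y. \<bar>x\<bar> < r \<Longrightarrow> \<bar>y\<bar> < r \<Longrightarrow>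
      ((\<lambda>(m, n). a m n * of_real x ^ m * of_real y ^ n) has_sum f (z + Complex x y)) UNIV"
    using assms z unfolding real_analytic_on_def by meson
  have "((\<lambda>(m, n). cnj (a m n) * of_real x ^ m * of_real y ^ n) has_sum cnj (f (z + Complex x y))) UNIV"
    if "\<bar>x\<bar> < r" "\<bar>y\<bar> < r" for x y
    using a[OF that] by (subst (asm) has_sum_cnj_iff[symmetric]) (simp add: case_prod_unfold)
  then show "\<exists>r>0. \<exists>a. \<forall>x y. \<bar>x\<bar> < r \<longrightarrow> \<bar>y\<bar> < r \<longrightarrow>
        ((\<lambda>(m, n). a m n * of_real x ^ m * of_real y ^ n) has_sum cnj (f (z + Complex x y))) UNIV"
    using r by (intro exI[of _ r] conjI exI[of _ "\<lambda>m n. cnj (a m n)"] allI impI) auto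
qed

text \<open>Convergence at a real displacement \<open>u\<close> strictly between \<open>s\<close>
  and \<open>r\<close> forces absolute convergence at \<open>s\<close>.\<close>

lemma power_series_abs_summable:
  assumes f: "f holomorphic_on ball z r" and s: "0 \<le> s" "s < r"
  shows "summable (\<lambda>n. norm ((deriv ^^ n) f z / fact n) * s ^ n)"
proof -
  obtain u where u: "s < u" "u < r" using s dense by blast
  then have "z + of_real u \<in> ball z r" using s by (simp add: dist_norm)
  then have "summable (\<lambda>n. (deriv ^^ n) f z / fact n * of_real u ^ n)"
    using holomorphic_power_series[OF f, of "z + of_real u"] by (simp add: sums_iff)
  then have "summable (\<lambda>n. norm ((deriv ^^ n) f z / fact n * of_real s ^ n))"
    by (rule powser_insidea) (use u s in simp)
  then show ?thesis using s by (simp only: norm_mult norm_power norm_of_real abs_of_nonneg)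
qed

lemma power_series_has_sum:
  assumes f: "f holomorphic_on ball z r" and w: "norm w < r"
  shows "((\<lambda>n. (deriv ^^ n) f z / fact n * w ^ n) has_sum f (z + w)) UNIV"
proof (rule norm_summable_imp_has_sum)
  show "summable (\<lambda>n. norm ((deriv ^^ n) f z / fact n * w ^ n))"
    using power_series_abs_summable[OF f norm_ge_zero w] by (simp only: norm_mult norm_power)
  show "(\<lambda>n. (deriv ^^ n) f z / fact n * w ^ n) sums f (z + w)"
    using holomorphic_power_series[OF f, of "z + w"] w by (simp add: dist_norm)
qed

text \<open>Expand \<open>(x + \<i> y)\<^sup>n\<close> by the binomial theorem; the resulting double series converges absolutely
  for \<open>\<bar>x\<bar> + \<bar>y\<bar> < r\<close>.\<close>

lemma holomorphic_imp_real_analytic_on: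
  assumes f: "f holomorphic_on S" and S: "open S"
  shows "f real_analytic_on S"
proof (rule real_analytic_onI)
  fix z assume "z \<in> S"
  then obtain r where r: "r > 0" "ball z r \<subseteq> S" using S open_contains_ball by blast
  have fb: "f holomorphic_on ball z r" using f r holomorphic_on_subset by blast
  define c where "c n = (deriv ^^ n) f z / fact n" for n
  define a where "a m n = c (m + n) * of_nat ((m + n) choose n) * \<i> ^ n" for m n
  have "((\<lambda>(m, n). a m n * of_real x ^ m * of_real y ^ n) has_sum f (z + Complex x y)) UNIV"
    if x: "\<bar>x\<bar> < r / 2" and y: "\<bar>y\<bar> < r / 2" for x y
  proof -
    let ?F = "\<lambda>(N, k). c N * of_nat (N choose k) * \<i> ^ k * of_real x ^ (N - k) * of_real y ^ k"
    have N: "(\<Sum>k\<le>N. c N * of_nat (N choose k) * \<i> ^ k * of_real x ^ (N - k) * of_real y ^ k)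
        = c N * (Complex x y) ^ N" for N
    proof -
      have "(Complex x y) ^ N = (\<i> * of_real y + of_real x) ^ N"
        by (simp add: Complex_eq add.commute)
      also have "\<dots> = (\<Sum>k\<le>N. of_nat (N choose k) * (\<i> * of_real y) ^ k * of_real x ^ (N - k))"
        by (rule binomial_ring)
      finally show ?thesis by (simp add: sum_distrib_left power_mult_distrib mult_ac)
    qed
    have normN: "(\<Sum>k\<le>N. norm (?F (N, k))) = norm (c N) * (\<bar>x\<bar> + \<bar>y\<bar>) ^ N" for N
    proof -
      have "(\<bar>y\<bar> + \<bar>x\<bar>) ^ N = (\<Sum>k\<le>N. of_nat (N choose k) * \<bar>y\<bar> ^ k * \<bar>x\<bar> ^ (N - k))"
        by (rule binomial_ring)
      then show ?thesis
        by (simp add: sum_distrib_left norm_mult norm_power add.commute mult_ac)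
    qed
    have s: "?F summable_on (SIGMA N:UNIV. {..N})"
    proof (rule abs_summable_summable, rule summable_on_SigmaI)
      show "((\<lambda>k. norm (?F (N, k))) has_sum norm (c N) * (\<bar>x\<bar> + \<bar>y\<bar>) ^ N) {..N}" for N
        unfolding normN[symmetric] by (rule has_sum_finite) simp
      show "(\<lambda>N. norm (c N) * (\<bar>x\<bar> + \<bar>y\<bar>) ^ N) summable_on UNIV"
        using power_series_abs_summable[OF fb, of "\<bar>x\<bar> + \<bar>y\<bar>"] x y
        by (subst summable_on_UNIV_nonneg_real_iff) (auto simp: c_def)
    qed auto
    have "norm (Complex x y) < r" using cmod_le[of "Complex x y"] x y by simp
    from power_series_has_sum[OF fb this]
    have h: "((\<lambda>N. c N * Complex x y ^ N) has_sum f (z + Complex x y)) UNIV"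
      by (simp add: c_def)
    have "(?F has_sum f (z + Complex x y)) (SIGMA N:UNIV. {..N})"
    proof (rule has_sum_SigmaI[OF _ h s])
      show "((\<lambda>k. ?F (N, k)) has_sum c N * Complex x y ^ N) {..N}" for N
        unfolding N[symmetric] using has_sum_finite[of "{..N}" "\<lambda>k. ?F (N, k)"] by simp
    qed
    then show ?thesis
      by (subst has_sum_reindex_bij_witness[where j = "\<lambda>(m, n). (m + n, n)" and i = "\<lambda>(N, k). (N - k, k)"
            and T = "SIGMA N:UNIV. {..N}" and h = ?F and s' = "f (z + Complex x y)"])
         (auto simp: a_def)
  qed
  then show "\<exists>r>0. \<exists>a. \<forall>x y. \<bar>x\<bar> < r \<longrightarrow> \<bar>y\<bar> < r \<longrightarrow>
        ((\<lambda>(m, n). a m n * of_real x ^ m * of_real y ^ n) has_sum f (z + Complex x y)) UNIV"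
    using r by (intro exI[of _ "r / 2"] conjI exI[of _ a] allI impI) auto
qed

text \<open>Meant for the terms in \<open>v\<close> alone, such as the logarithm, viewed as
  restrictions of holomorphic functions: the Taylor series at \<open>Im z\<close> gives the
  coefficients with \<open>m = 0\<close>, and all others vanish.\<close>

lemma real_analytic_on_compose_Im:
  assumes f: "f holomorphic_on T" and T: "open T" and S: "\<And>z. z \<in> S \<Longrightarrow> of_real (Im z) \<in> T"
  shows "(\<lambda>z. f (of_real (Im z))) real_analytic_on S"
proof (rule real_analytic_onI)
  fix z assume "z \<in> S"
  then obtain r where r: "r > 0" "ball (of_real (Im z)) r \<subseteq> T" using S T open_contains_ball by blast
  have fb: "f holomorphic_on ball (of_real (Im z)) r" using f r holomorphic_on_subset by blast
  define c where "c n = (deriv ^^ n) f (of_real (Im z)) / fact n" for n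
  define a where "a m n = (if m = 0 then c n else 0)" for m n :: nat
  have "((\<lambda>(m, n). a m n * of_real x ^ m * of_real y ^ n) has_sum f (of_real (Im (z + Complex x y)))) UNIV"
    if y: "\<bar>y\<bar> < r" for x y
  proof -
    have "((\<lambda>n. c n * of_real y ^ n) has_sum f (of_real (Im z) + of_real y)) UNIV"
      unfolding c_def by (rule power_series_has_sum[OF fb]) (use y in simp)
    then have "((\<lambda>(m, n). a m n * of_real x ^ m * of_real y ^ n) has_sum f (of_real (Im z) + of_real y)) (Pair 0 ` UNIV)"
      by (subst has_sum_reindex) (auto simp: a_def o_def inj_on_def)
    then have "((\<lambda>(m, n). a m n * of_real x ^ m * of_real y ^ n) has_sum f (of_real (Im z) + of_real y)) UNIV"
      by (subst has_sum_cong_neutral[where T = "Pair 0 ` UNIV" and g = "\<lambda>(m, n). a m n * of_real x ^ m * of_real y ^ n"]) (auto simp: a_def)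
    then show ?thesis by simp
  qed
  then show "\<exists>r>0. \<exists>a. \<forall>x y. \<bar>x\<bar> < r \<longrightarrow> \<bar>y\<bar> < r \<longrightarrow>
        ((\<lambda>(m, n). a m n * of_real x ^ m * of_real y ^ n) has_sum f (of_real (Im (z + Complex x y)))) UNIV"
    using r by (intro exI[of _ r] conjI exI[of _ a] allI impI) auto
qed

lemma real_analytic_on_cong:
  assumes "f real_analytic_on S" and S: "open S" and eq: "\<And>z. z \<in> S \<Longrightarrow> f z = g z"
  shows "g real_analytic_on S"
proof (rule real_analytic_onI)
  fix z assume z: "z \<in> S"
  obtain r a where r: "r > 0" and a: "\<And>x y. \<bar>x\<bar> < r \<Longrightarrow> \<bar>y\<bar> < r \<Longrightarrow>
      ((\<lambda>(m, n). a m n * of_real x ^ m * of_real y ^ n) has_sum f (z + Complex x y)) UNIV"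
    using assms(1) z unfolding real_analytic_on_def by meson
  obtain e where e: "e > 0" "ball z e \<subseteq> S" using S z open_contains_ball by blast
  have "f (z + Complex x y) = g (z + Complex x y)" if "\<bar>x\<bar> < e / 2" "\<bar>y\<bar> < e / 2" for x y
  proof -
    have "norm (Complex x y) < e" using cmod_le[of "Complex x y"] that by simp
    then have "z + Complex x y \<in> ball z e" by (simp add: dist_norm)
    then show ?thesis using e eq by blast
  qed
  then have "((\<lambda>(m, n). a m n * of_real x ^ m * of_real y ^ n) has_sum g (z + Complex x y)) UNIV"
    if "\<bar>x\<bar> < min r (e / 2)" "\<bar>y\<bar> < min r (e / 2)" for x y
    using a[of x y] that by simp
  then show "\<exists>r>0. \<exists>a. \<forall>x y. \<bar>x\<bar> < r \<longrightarrow> \<bar>y\<bar> < r \<longrightarrow>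
        ((\<lambda>(m, n). a m n * of_real x ^ m * of_real y ^ n) has_sum g (z + Complex x y)) UNIV"
    using r e by (intro exI[of _ "min r (e / 2)"] conjI exI[of _ a] allI impI) auto
qed

subsection \<open>The Wirtinger derivative and Lambert series\<close>

text \<open>Closed formulas for the functions and their shadows hold only on the half-plane;
  openness lets them be differentiated.\<close>

lemma dbar_cong:
  assumes S: "open S" "t \<in> S" and eq: "\<And>z. z \<in> S \<Longrightarrow> f z = g z"
  shows "dbar f t = dbar g t"
proof -
  have "vector_derivative (\<lambda>s. f (t + c * of_real s)) (at 0) = vector_derivative (\<lambda>s. g (t + c * of_real s)) (at 0)" for c
  proof (rule vector_derivative_cong_eq)
    have "open ((\<lambda>s. t + c * of_real s) -` S)"
      by (intro open_vimage S continuous_intros)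
    moreover have "0 \<in> (\<lambda>s. t + c * of_real s) -` S" using S by simp
    ultimately show "\<forall>\<^sub>F s in nhds 0. s \<in> UNIV \<longrightarrow> f (t + c * of_real s) = g (t + c * of_real s)"
      unfolding eventually_nhds using eq by (intro exI[of _ "(\<lambda>s. t + c * of_real s) -` S"]) auto
  qed auto
  from this[of 1] this[of \<i>] show ?thesis unfolding dbar_def by simp
qed

lemma has_vector_derivative_affine:
  fixes f :: "complex \<Rightarrow> complex"
  assumes "(f has_field_derivative D) (at t)"
  shows "((\<lambda>s. f (t + c * of_real s)) has_vector_derivative (c * D)) (at 0)"
proof -
  have "((\<lambda>s::real. t + c * of_real s) has_vector_derivative c) (at 0)"
    by (auto intro!: derivative_eq_intros simp: has_vector_derivative_def scaleR_conv_of_real)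
  moreover have "(f has_field_derivative D) (at (t + c * of_real 0))" using assms by simp
  ultimately show ?thesis using field_vector_diff_chain_at by (fastforce simp: o_def)
qed

text \<open>Relational companion of \<open>dbar\<close>: it records that both directional
  derivatives exist, which the total operator \<open>vector_derivative\<close> does not, and so it
  admits a sum rule.\<close>

definition has_dbar :: "(complex \<Rightarrow> complex) \<Rightarrow> complex \<Rightarrow> complex \<Rightarrow> bool" where
  "has_dbar f D t \<longleftrightarrow> (\<exists>p q. ((\<lambda>s. f (t + of_real s)) has_vector_derivative p) (at 0) \<and>
     ((\<lambda>s. f (t + \<i> * of_real s)) has_vector_derivative q) (at 0) \<and> D = (p + \<i> * q) / 2)"

lemma has_dbar_imp_dbar: "has_dbar f D t \<Longrightarrow> dbar f t = D"
  unfolding has_dbar_def dbar_def by (auto simp: vector_derivative_at)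

lemma has_dbar_add:
  assumes "has_dbar f D t" "has_dbar g E t"
  shows "has_dbar (\<lambda>z. f z + g z) (D + E) t"
proof -
  obtain p q p' q' where *: "((\<lambda>s. f (t + of_real s)) has_vector_derivative p) (at 0)"
     "((\<lambda>s. f (t + \<i> * of_real s)) has_vector_derivative q) (at 0)" "D = (p + \<i> * q) / 2"
     "((\<lambda>s. g (t + of_real s)) has_vector_derivative p') (at 0)"
     "((\<lambda>s. g (t + \<i> * of_real s)) has_vector_derivative q') (at 0)" "E = (p' + \<i> * q') / 2"
    using assms unfolding has_dbar_def by blast
  then have "D + E = ((p + p') + \<i> * (q + q')) / 2" by (simp add: field_simps)
  with * show ?thesis
    unfolding has_dbar_def
    by (intro exI[of _ "p + p'"] exI[of _ "q + q'"] conjI has_vector_derivative_add)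
qed

lemma has_dbar_holomorphic:
  assumes "(f has_field_derivative D) (at t)"
  shows "has_dbar f 0 t"
  unfolding has_dbar_def
  using has_vector_derivative_affine[OF assms, of 1] has_vector_derivative_affine[OF assms, of \<i>]
  by (intro exI[of _ D] exI[of _ "\<i> * D"]) simp

text \<open>Conjugation reverses the Cauchy-Riemann relation, so the horizontal and vertical
  contributions agree instead of cancelling.\<close>

lemma has_dbar_cnj_holomorphic:
  assumes "(f has_field_derivative D) (at t)"
  shows "has_dbar (\<lambda>z. cnj (f z)) (cnj D) t"
  unfolding has_dbar_def
  using has_vector_derivative_cnj[OF has_vector_derivative_affine[OF assms, of 1]]
    has_vector_derivative_cnj[OF has_vector_derivative_affine[OF assms, of \<i>]]
  by (intro exI[of _ "cnj D"] exI[of _ "cnj (\<i> * D)"]) simp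

lemma has_dbar_of_real_Im:
  assumes "(f has_real_derivative D) (at (Im t))"
  shows "has_dbar (\<lambda>z. of_real (f (Im z))) (\<i> * of_real D / 2) t"
proof -
  have "((\<lambda>s. f (Im t + s)) has_real_derivative D) (at 0)"
    using assms DERIV_shift[of f D 0 "Im t"] by (simp add: add.commute)
  then have "((\<lambda>s. of_real (f (Im t + s)) :: complex) has_vector_derivative of_real D) (at 0)"
    using has_vector_derivative_of_real has_real_derivative_iff_has_vector_derivative by blast
  then show ?thesis
    unfolding has_dbar_def by (intro exI[of _ 0] exI[of _ "of_real D"]) simp
qed

text \<open>Write \<open>q\<^sup>n / (1 - q\<^sup>n)\<^sup>2\<close> as \<open>\<Sum>d. d q\<^sup>n\<^sup>d\<close> and collect the pairs \<open>(n, d)\<close> by their product.\<close>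

lemma lambert_series_sigma1:
  fixes q :: complex
  assumes q: "norm q < 1"
  shows "(\<lambda>n. of_nat (sigma1 (Suc n)) * q ^ Suc n) sums (\<Sum>n. q ^ Suc n / (1 - q ^ Suc n)\<^sup>2)"
proof -
  let ?r = "norm q"
  let ?P = "{0<..} :: nat set"
  define F where "F = (\<lambda>(n, d). of_nat d * q ^ (n * d))"
  \<comment> \<open>Polymorphic because it serves twice: over the complex numbers for the rows, over
    the reals for their norms.\<close>
  have geo: "((\<lambda>d. of_nat d * x ^ d) has_sum x / (1 - x)\<^sup>2) ?P"
    if x: "norm x < 1" for x :: "'a :: {real_normed_field, banach}"
  proof -
    have "(\<lambda>n. of_nat (Suc n) * x ^ n) sums (1 / (1 - x)\<^sup>2)" by (rule geometric_deriv_sums[OF x])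
    then have s: "(\<lambda>n. of_nat (Suc n) * x ^ Suc n) sums (x / (1 - x)\<^sup>2)"
      using sums_mult[of _ _ x] by (fastforce simp: mult_ac)
    have "(\<lambda>n. of_nat (Suc n) * norm x ^ n) sums (1 / (1 - norm x)\<^sup>2)"
      by (rule geometric_deriv_sums) (use x in simp)
    then have "summable (\<lambda>n. norm x * (of_nat (Suc n) * norm x ^ n))"
      by (intro summable_mult sums_summable)
    then have "summable (\<lambda>n. norm (of_nat (Suc n) * x ^ Suc n))"
      by (simp add: norm_mult norm_power mult_ac del: of_nat_Suc)
    from norm_summable_imp_has_sum[OF this s]
    have "((\<lambda>d. of_nat d * x ^ d) \<circ> Suc has_sum x / (1 - x)\<^sup>2) UNIV" by (simp add: o_def)
    moreover have "range Suc = ?P" by (rule greaterThan_0[symmetric])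
    ultimately show ?thesis by (metis has_sum_reindex inj_Suc)
  qed
  have qn: "norm (q ^ n) < 1" if "n \<in> ?P" for n
    using power_strict_mono[of ?r 1 n] q that by (simp add: norm_power)
  have rows: "((\<lambda>d. F (n, d)) has_sum q ^ n / (1 - q ^ n)\<^sup>2) ?P" if "n \<in> ?P" for n
    using geo[OF qn[OF that]] by (simp add: F_def power_mult)
  have summ: "F summable_on ?P \<times> ?P"
  proof (rule abs_summable_summable, rule summable_on_SigmaI)
    fix n assume n: "n \<in> ?P"
    have "norm (?r ^ n) < 1" using qn[OF n] by (simp add: norm_power)
    from geo[OF this]
    show "((\<lambda>d. norm (F (n, d))) has_sum ?r ^ n / (1 - ?r ^ n)\<^sup>2) ?P"
      by (simp add: F_def norm_mult norm_power power_mult)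
  next
    \<comment> \<open>The row norms form the same Lambert series at \<open>norm q\<close>; embedding
      the reals reuses the complex bound.\<close>
    have "summable (\<lambda>n. norm (complex_of_real ?r ^ Suc n / (1 - complex_of_real ?r ^ Suc n)\<^sup>2))"
      by (rule summable_comparison_test'[OF summable_geometric_Suc[of ?r "1 / (1 - ?r)\<^sup>2"], of 0])
         (use q norm_lambert_deriv_term_le[of "complex_of_real ?r" ?r] in auto)
    moreover have "norm (complex_of_real ?r ^ n / (1 - complex_of_real ?r ^ n)\<^sup>2) = ?r ^ n / (1 - ?r ^ n)\<^sup>2" for n
    proof -
      have "complex_of_real ?r ^ n / (1 - complex_of_real ?r ^ n)\<^sup>2 = of_real (?r ^ n / (1 - ?r ^ n)\<^sup>2)" by simp
      then show ?thesis by (simp only: norm_of_real) simp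
    qed
    ultimately have "summable (\<lambda>n. ?r ^ Suc n / (1 - ?r ^ Suc n)\<^sup>2)" by (simp only:)
    then have "(\<lambda>n. ?r ^ Suc n / (1 - ?r ^ Suc n)\<^sup>2) summable_on UNIV"
      by (subst summable_on_UNIV_nonneg_real_iff) auto
    then have "(\<lambda>n. ?r ^ n / (1 - ?r ^ n)\<^sup>2) summable_on range Suc"
      by (subst summable_on_reindex) (auto simp: o_def)
    moreover have "range Suc = ?P" by (rule greaterThan_0[symmetric])
    ultimately show "(\<lambda>n. ?r ^ n / (1 - ?r ^ n)\<^sup>2) summable_on ?P" by simp
  qed auto
  define S where "S = infsum F (?P \<times> ?P)"
  have FS: "(F has_sum S) (?P \<times> ?P)" unfolding S_def by (rule has_sum_infsum[OF summ])
  have shift: "(\<lambda>n. g (Suc n)) sums S" if "(g has_sum S) ?P" for g :: "nat \<Rightarrow> complex"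
  proof -
    have "range Suc = ?P" by (rule greaterThan_0[symmetric])
    then have "(g \<circ> Suc has_sum S) UNIV" using that has_sum_reindex[of Suc UNIV g S] by simp
    then show ?thesis using has_sum_imp_sums by (fastforce simp: o_def)
  qed
  have "(\<lambda>n. q ^ Suc n / (1 - q ^ Suc n)\<^sup>2) sums S"
    by (rule shift, rule has_sum_SigmaD[OF FS rows])
  then have "S = (\<Sum>n. q ^ Suc n / (1 - q ^ Suc n)\<^sup>2)" by (simp add: sums_iff)
  moreover have "((\<lambda>(N, d). of_nat d * q ^ N) has_sum S) (SIGMA N:?P. {d. d dvd N})"
    using FS
    by (subst has_sum_reindex_bij_witness[where i = "\<lambda>(n, d). (n * d, d)" and j = "\<lambda>(N, d). (N div d, d)"
          and h = F and T = "?P \<times> ?P" and s' = S])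
       (auto simp: F_def dvd_div_mult_self intro: Nat.gr0I)
  then have "((\<lambda>N. \<Sum>d | d dvd N. of_nat d * q ^ N) has_sum S) ?P"
    by (rule has_sum_SigmaD) (auto intro!: has_sum_finite)
  then have "((\<lambda>N. of_nat (sigma1 N) * q ^ N) has_sum S) ?P"
    by (simp add: sigma1_def sum_distrib_right)
  from shift[OF this] have "(\<lambda>n. of_nat (sigma1 (Suc n)) * q ^ Suc n) sums S" .
  ultimately show ?thesis by simp
qed

subsection \<open>The shadow\<close>

text \<open>On the upper half-plane this is \<open>g1 (nome t)\<close>, in a form that inherits
  holomorphy from \<open>lambert_log\<close>.\<close>

definition g1_log :: "complex \<Rightarrow> complex" where
  "g1_log t = lambert_log t - 2 * lambert_log (2 * t)"

lemma g1_log_has_field_derivative: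
  assumes t: "Im t > 0"
  shows "(g1_log has_field_derivative 2 * of_real pi * \<i> * (lambert_deriv t - 4 * lambert_deriv (2 * t))) (at t)"
proof -
  have "((\<lambda>t. lambert_log (2 * t)) has_field_derivative (2 * of_real pi * \<i> * lambert_deriv (2 * t)) * 2) (at t)"
    by (rule DERIV_chain2[OF lambert_log_has_field_derivative]) (use t in \<open>auto intro!: derivative_eq_intros\<close>)
  from DERIV_diff[OF lambert_log_has_field_derivative[OF t] DERIV_cmult[OF this, of 2]]
  show ?thesis unfolding g1_log_def[abs_def] by (simp add: algebra_simps)
qed

lemma g1_log_holomorphic: "g1_log holomorphic_on \<H>"
  unfolding holomorphic_on_open[OF open_upper_half_plane]
  by (intro ballI exI, rule g1_log_has_field_derivative) simp

lemma g1_hat_eq: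
  obtains c where "\<And>t. Im t > 0 \<Longrightarrow>
    g1_hat t = c + of_real (ln (Im t) / 2 - pi / 2 * Im t) + (g1_log t + cnj (g1_log t))"
proof
  show "g1_hat t = (2 * of_real (ln 2) - euler_mascheroni + 6 * deriv Riemann_zeta 2 / of_real pi ^ 2)
      + of_real (ln (Im t) / 2 - pi / 2 * Im t) + (g1_log t + cnj (g1_log t))" if t: "Im t > 0" for t
    unfolding g1_hat_def g1_nome[OF t] g1_cnj_nome[OF t] g1_log_def by simp
qed

lemma g1_hat_real_analytic: "g1_hat real_analytic_on \<H>"
proof -
  obtain c where c: "\<And>t. Im t > 0 \<Longrightarrow>
      g1_hat t = c + of_real (ln (Im t) / 2 - pi / 2 * Im t) + (g1_log t + cnj (g1_log t))"
    by (rule g1_hat_eq) blast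
  let ?f = "\<lambda>w. c + (Ln w / 2 - of_real pi / 2 * w)"
  have f: "(\<lambda>t. ?f (of_real (Im t))) real_analytic_on \<H>"
  proof (rule real_analytic_on_compose_Im[where f = ?f and T = "- \<real>\<^sub>\<le>\<^sub>0"])
    show "?f holomorphic_on - \<real>\<^sub>\<le>\<^sub>0" by (intro holomorphic_intros) auto
    show "open (- \<real>\<^sub>\<le>\<^sub>0 :: complex set)" by (rule open_Compl) simp
  qed (auto simp: complex_nonpos_Reals_iff)
  have g: "g1_log real_analytic_on \<H>"
    by (rule holomorphic_imp_real_analytic_on[OF g1_log_holomorphic open_upper_half_plane])
  have "(\<lambda>t. ?f (of_real (Im t)) + (g1_log t + cnj (g1_log t))) real_analytic_on \<H>"
    by (rule real_analytic_on_add[OF f real_analytic_on_add[OF g real_analytic_on_cnj[OF g]]])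
  then show ?thesis
    by (rule real_analytic_on_cong[OF _ open_upper_half_plane]) (simp add: c Ln_of_real)
qed

text \<open>\<open>dbar\<close> annihilates the holomorphic part and differentiates its conjugate;
  the conjugation in \<open>\<xi>\<close> then returns the holomorphic derivative. The part in
  \<open>v\<close> contributes its ordinary derivative.\<close>

lemma shadow_g1_hat:
  assumes t: "Im t > 0"
  shows "\<xi> 0 g1_hat t = of_real (1 / (2 * Im t) - pi / 2) + 2 * \<i> * deriv g1_log t"
proof -
  obtain c where c: "\<And>t. Im t > 0 \<Longrightarrow>
      g1_hat t = c + of_real (ln (Im t) / 2 - pi / 2 * Im t) + (g1_log t + cnj (g1_log t))"
    by (rule g1_hat_eq) blast
  note g = DERIV_imp_deriv[OF g1_log_has_field_derivative[OF t], symmetric]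
  have G: "(g1_log has_field_derivative deriv g1_log t) (at t)"
    using g1_log_has_field_derivative[OF t] unfolding g .
  have "has_dbar (\<lambda>t. c + of_real (ln (Im t) / 2 - pi / 2 * Im t) + (g1_log t + cnj (g1_log t)))
    (0 + \<i> * of_real (1 / (2 * Im t) - pi / 2) / 2 + (0 + cnj (deriv g1_log t))) t"
    by (intro has_dbar_add has_dbar_of_real_Im[of "\<lambda>v. ln v / 2 - pi / 2 * v"] has_dbar_holomorphic[OF DERIV_const]
        has_dbar_holomorphic[OF G] has_dbar_cnj_holomorphic[OF G])
       (use t in \<open>auto intro!: derivative_eq_intros\<close>)
  then have "dbar (\<lambda>t. c + of_real (ln (Im t) / 2 - pi / 2 * Im t) + (g1_log t + cnj (g1_log t))) t
      = \<i> * of_real (1 / (2 * Im t) - pi / 2) / 2 + cnj (deriv g1_log t)"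
    by (simp add: has_dbar_imp_dbar)
  moreover have "dbar g1_hat t = dbar (\<lambda>t. c + of_real (ln (Im t) / 2 - pi / 2 * Im t) + (g1_log t + cnj (g1_log t))) t"
    by (rule dbar_cong[OF open_upper_half_plane]) (use t in \<open>simp_all only: upper_half_plane_iff c\<close>)
  ultimately have "dbar g1_hat t = \<i> * of_real (1 / (2 * Im t) - pi / 2) / 2 + cnj (deriv g1_log t)"
    by (simp only:)
  moreover have "2 * \<i> * cnj (\<i> * of_real x / 2 + cnj w) = of_real x + 2 * \<i> * w" for x w
    by (simp add: algebra_simps)
  ultimately show ?thesis unfolding shadow_def power_int_0_right by (simp only: mult_1_right)
qed

text \<open>Only \<open>1 / (2 * v)\<close> fails to be holomorphic in the first shadow, and the
  weight factor \<open>v^2\<close> cancels the \<open>1 / v^2\<close> of its derivative.\<close>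

lemma shadow_shadow_g1_hat:
  assumes t: "Im t > 0"
  shows "\<xi> 2 (\<xi> 0 g1_hat) t = - 1 / 2"
proof -
  have "(deriv g1_log has_field_derivative deriv (deriv g1_log) t) (at t)"
    by (rule holomorphic_derivI[OF holomorphic_deriv[OF g1_log_holomorphic open_upper_half_plane] open_upper_half_plane])
       (use t in simp)
  then have G: "((\<lambda>z. 2 * \<i> * deriv g1_log z) has_field_derivative 2 * \<i> * deriv (deriv g1_log) t) (at t)"
    by (rule DERIV_cmult)
  have "has_dbar (\<lambda>t. of_real (1 / (2 * Im t) - pi / 2) + 2 * \<i> * deriv g1_log t)
      (\<i> * of_real (- (1 / (2 * (Im t)\<^sup>2))) / 2 + 0) t"
    by (intro has_dbar_add has_dbar_of_real_Im[of "\<lambda>v. 1 / (2 * v) - pi / 2"] has_dbar_holomorphic[OF G])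
       (use t in \<open>auto intro!: derivative_eq_intros simp: power2_eq_square field_simps\<close>)
  then have "dbar (\<lambda>t. of_real (1 / (2 * Im t) - pi / 2) + 2 * \<i> * deriv g1_log t) t
      = \<i> * of_real (- (1 / (2 * (Im t)\<^sup>2))) / 2"
    by (simp add: has_dbar_imp_dbar)
  moreover have "dbar (\<xi> 0 g1_hat) t = dbar (\<lambda>t. of_real (1 / (2 * Im t) - pi / 2) + 2 * \<i> * deriv g1_log t) t"
    by (rule dbar_cong[OF open_upper_half_plane]) (use t in \<open>simp_all only: upper_half_plane_iff shadow_g1_hat\<close>)
  ultimately have d: "dbar (\<xi> 0 g1_hat) t = \<i> * of_real (- (1 / (2 * (Im t)\<^sup>2))) / 2"
    by (simp only:)
  show ?thesis
    unfolding shadow_def[of 2 "\<xi> 0 g1_hat"] d using t by (simp add: field_simps power2_eq_square)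
qed

lemma shadow_shadow_shadow_g1_hat:
  assumes t: "Im t > 0"
  shows "\<xi> 0 (\<xi> 2 (\<xi> 0 g1_hat)) t = 0"
proof -
  have "dbar (\<xi> 2 (\<xi> 0 g1_hat)) t = dbar (\<lambda>_. - 1 / 2) t"
    by (rule dbar_cong[OF open_upper_half_plane]) (use t in \<open>simp_all only: upper_half_plane_iff shadow_shadow_g1_hat\<close>)
  also have "\<dots> = 0" by (rule has_dbar_imp_dbar[OF has_dbar_holomorphic[OF DERIV_const]])
  finally show ?thesis by (simp add: shadow_def)
qed

lemma E2_hat_eq:
  assumes t: "Im t > 0"
  shows "E2_hat t = 1 - 24 * lambert_deriv t - 3 / (of_real pi * of_real (Im t))"
  using lambert_series_sigma1[OF norm_nome_less_one[OF t]]
  by (simp add: E2_hat_def lambert_deriv_def sums_iff)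

theorem theorem1p1:
  shows "sesquiharmonic_Maass_form 0 2 g1_hat \<and>
    (\<forall>\<tau>\<in>\<H>. \<xi> 0 g1_hat \<tau> = of_real pi / 6 * (E2_hat \<tau> - 4 * E2_hat (2 * \<tau>)))"
proof
  show "sesquiharmonic_Maass_form 0 2 g1_hat"
    unfolding sesquiharmonic_Maass_form_def
    using g1_hat_real_analytic g1_hat_moebius g1_hat_growth shadow_shadow_shadow_g1_hat by simp
  show "\<forall>\<tau>\<in>\<H>. \<xi> 0 g1_hat \<tau> = of_real pi / 6 * (E2_hat \<tau> - 4 * E2_hat (2 * \<tau>))"
  proof
    fix t assume "t \<in> \<H>"
    then have t: "Im t > 0" "Im (2 * t) > 0" by simp_all
    \<comment> \<open>Three coefficients match: \<open>1 - 4 = -3\<close> gives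
      \<open>- \<pi> / 2\<close>, the polar terms combine to \<open>3 / (\<pi> * v)\<close> and give
      \<open>1 / (2 * v)\<close>, and \<open>-24 * \<pi> / 6 = 2 * \<i> * (2 * \<pi> * \<i>)\<close>
      treats the Lambert series.\<close>
    then show "\<xi> 0 g1_hat t = of_real pi / 6 * (E2_hat t - 4 * E2_hat (2 * t))"
      unfolding shadow_g1_hat[OF t(1)] E2_hat_eq[OF t(1)] E2_hat_eq[OF t(2)]
        DERIV_imp_deriv[OF g1_log_has_field_derivative[OF t(1)]]
      by (simp add: field_simps)
  qed
qed

end
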